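(* Let $q$ be a prime power, $n \geq 5$, and let $S \subset \mathbb{F}_q^n$ with $|S| > q^4$. Let $\tau > 0$ and $\delta \in (0,1)$ be such that $q \geq 32\max(n(1+\tau)/(\tau\delta)^2,\, n)$. Let $4 \leq r \leq n-1$ be the integer with $q^r < |S| \leq q^{r+1}$ and let $k = n - r + 3$. Then at least a $(1-\delta)$-fraction of all subspaces in $\mathcal{L}_k^*(\mathbb{F}_q^n)$ are $\tau$-shift-balanced with respect to $S$.
   Context: For $1 \le k \le n$, $\mathcal{L}_k(\mathbb{F}_q^n)$ denotes the set of $k$-dimensional affine subspaces ($k$-flats) of $\mathbb{F}_q^n$ and $\mathcal{L}_k^*(\mathbb{F}_q^n)$ the set of $k$-dimensional linear subspaces. For $S \subset \mathbb{F}_q^n$, $E_k(S) = |S|/q^{n-k}$. A flat $R \in \mathcal{L}_k(\mathbb{F}_q^n)$ is $\tau$-balanced with respect to $S$ if $\big||R \cap S| - E_k(S)\big| \leq \tau E_k(S)$, and $\tau$-unbalanced otherwise. A subspace $A \in \mathcal{L}_k^*(\mathbb{F}_q^n)$ is $\tau$-shift-balanced with respect to $S$ if for every $a \in \mathbb{F}_q^n$ the flat $A + a$ is $\tau$-balanced with respect to $S$. *)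

theory Defs
  imports "HOL-Analysis.Analysis"
begin

text \<open>Ambient space: F_q^n is modelled as the type 'a^'n with 'a a finite field
(so q = CARD('a), automatically a prime power) and n = CARD('n).\<close>

definition linsubs :: "nat \<Rightarrow> (('a::{field,finite})^'n) set set" where
  "linsubs k = {A. vec.subspace A \<and> vec.dim A = k}"

definition flats :: "nat \<Rightarrow> (('a::{field,finite})^'n) set set" where
  "flats k = {(\<lambda>x. x + a) ` A | A a. A \<in> linsubs k}"

definition Ek :: "nat \<Rightarrow> (('a::{field,finite})^'n) set \<Rightarrow> real" where
  "Ek k S = real (card S) / real CARD('a) ^ (CARD('n) - k)"

definition balanced :: "real \<Rightarrow> nat \<Rightarrow> (('a::{field,finite})^'n) set \<Rightarrow> ('a^'n) set \<Rightarrow> bool" where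
  "balanced \<tau> k S R \<longleftrightarrow> \<bar>real (card (R \<inter> S)) - Ek k S\<bar> \<le> \<tau> * Ek k S"

definition shift_balanced :: "real \<Rightarrow> nat \<Rightarrow> (('a::{field,finite})^'n) set \<Rightarrow> ('a^'n) set \<Rightarrow> bool" where
  "shift_balanced \<tau> k S A \<longleftrightarrow> (\<forall>a. balanced \<tau> k S ((\<lambda>x. x + a) ` A))"

end

theory Submission
  imports Defs "HOL-Computational_Algebra.Fraction_Field"
begin

text \<open>Write \<open>k = c + 2\<close>, so that a flat of dimension \<open>c\<close> contains more than \<open>q\<close> points of \<open>S\<close> on average.
  Suppose that more than a \<open>\<delta>\<close>-fraction of the \<open>k\<close>-dimensional subspaces \<open>A\<close> has an unbalanced
  translate \<open>A + a\<close>. For a random \<open>c\<close>-dimensional \<open>C\<close>, let \<open>X\<close> be the set of points \<open>x\<close> for which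
  \<open>C + x\<close> is not \<open>\<tau>/2\<close>-balanced. Two applications of Chebyshev's inequality show that \<open>X\<close> has small
  density, while most of the bad flats \<open>A + a\<close> with \<open>C \<subseteq> A\<close> are almost contained in \<open>X\<close>.
  As \<open>X\<close> is \<open>C\<close>-invariant, it contains almost all of some plane
  \<open>{a + s b1 + t b2}\<close> for a positive proportion \<open>\<gamma>\<close> of pairs \<open>(b1, b2)\<close>.
  The union of about \<open>1/\<gamma>\<close> images of \<open>X\<close> under linear automorphisms still has density at most
  \<open>2/5\<close> but serves half of all pairs.

  This contradicts a Kakeya theorem for planes, proved by the polynomial method with multiplicities:
  a polynomial vanishing to high order on the set vanishes, with many Hasse derivatives, on the planes.
  So its top-degree part vanishes to high order at the points \<open>b1 + u b2\<close> for any \<open>u\<close> in an extension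
  field; these lie in a grid of side \<open>q\<^sup>2\<close> rather than \<open>q\<close>, which is what makes planes much
  better than lines.\<close>

section \<open>Polynomial functions and directional Hasse derivatives\<close>

text \<open>The grid side decides the strength of the bound. A polynomial of degree \<open>d\<close>
  vanishing to order \<open>M\<close> on the set vanishes to order \<open>l\<close> at the
  directions, and the contradiction needs \<open>l\<close> to exceed \<open>d\<close> divided by the
  side of the grid, up to the density of the directions. For lines (side \<open>q\<close>)
  \<open>l\<close> is comparable with \<open>M\<close>, both about \<open>d/q\<close>, and the bound
  \<open>(d/M)^n\<close> for the size of the set loses a constant to the power \<open>n\<close>. For
  planes (side \<open>q^2\<close>) the ratio \<open>l/M\<close> is about \<open>4/q\<close>, so with
  \<open>q \<ge> 32 n\<close> the loss over all \<open>n\<close> factors stays bounded. The same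
  accounting tolerates a missing fraction \<open>1/(4n)\<close> of each plane; hence the factor
  \<open>4 n\<close> throughout. A sparse family of pairs would push \<open>l\<close> up by
  \<open>1/\<gamma>\<close>; the copies of \<open>X\<close> avoid this at the price of density,
  which the Chebyshev bound leaves room for. Polynomials are handled as functions, with derivatives
  read off from restrictions to lines. This is faithful only over an infinite field, so the argument
  runs over rational functions, whose indeterminate also serves as \<open>u\<close>.\<close>

inductive polyfun :: "nat \<Rightarrow> ('k::field^'n \<Rightarrow> 'k) \<Rightarrow> bool" where
  const: "polyfun d (\<lambda>x. c)"
| coord: "polyfun d f \<Longrightarrow> polyfun (Suc d) (\<lambda>x. x $ i * f x)"
| add: "polyfun d f \<Longrightarrow> polyfun d g \<Longrightarrow> polyfun d (\<lambda>x. f x + g x)"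

lemma polyfun_mono: "polyfun d f \<Longrightarrow> d \<le> d' \<Longrightarrow> polyfun d' f"
proof (induction arbitrary: d' rule: polyfun.induct)
  case (coord d f i)
  then obtain d'' where "d' = Suc d''" "d \<le> d''" by (cases d') auto
  with coord show ?case by (auto intro: polyfun.coord)
qed (auto intro: polyfun.intros)

lemma polyfun_cmult: "polyfun d f \<Longrightarrow> polyfun d (\<lambda>x. c * f x)"
proof (induction rule: polyfun.induct)
  case (coord d f i)
  then show ?case using polyfun.coord[of d "\<lambda>x. c * f x" i] by (simp add: mult.left_commute)
next
  case (add d f g)
  then show ?case using polyfun.add by (fastforce simp: distrib_left)
qed (auto intro: polyfun.intros)

lemma polyfun_sum: "(\<And>a. a \<in> A \<Longrightarrow> polyfun d (f a)) \<Longrightarrow> polyfun d (\<lambda>x. \<Sum>a\<in>A. f a x)"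
  by (induction A rule: infinite_finite_induct) (auto intro: polyfun.intros)

lemma polyfun_coord_power: "polyfun d f \<Longrightarrow> polyfun (k + d) (\<lambda>x. (x $ i) ^ k * f x)"
proof (induction k)
  case (Suc k)
  then show ?case using polyfun.coord[of "k + d" "\<lambda>x. (x $ i) ^ k * f x" i] by (simp add: mult.assoc)
qed simp

lemma polyfun_translate: "polyfun d f \<Longrightarrow> polyfun d (\<lambda>y. f (x + y))"
proof (induction rule: polyfun.induct)
  case (coord d f i)
  have "polyfun (Suc d) (\<lambda>y. y $ i * f (x + y) + x $ i * f (x + y))"
    using coord.IH by (intro polyfun.add polyfun.coord polyfun_cmult polyfun_mono[of d _ "Suc d"]) auto
  then show ?case by (simp add: algebra_simps)
qed (auto intro: polyfun.intros)

text \<open>By induction on the construction of \<open>f\<close>. The functions \<open>g j\<close>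
  become the Hasse derivatives in direction \<open>y\<close>. Vanishing for \<open>j > d\<close> is
  a separate clause because \<open>d - j\<close> is truncated there and would still admit
  constants.\<close>

lemma polyfun_taylor:
  assumes "polyfun d f"
  shows "\<exists>g. (\<forall>j. polyfun (d - j) (g j)) \<and> (\<forall>j>d. \<forall>x. g j x = 0) \<and>
             (\<forall>x e. f (x + e *s y) = (\<Sum>j\<le>d. g j x * e ^ j))"
  using assms
proof (induction rule: polyfun.induct)
  case (const d c)
  show ?case
    by (rule exI[of _ "\<lambda>j x. if j = 0 then c else 0"])
       (auto intro: polyfun.intros simp: if_distrib[of "\<lambda>x. x * _"] cong: if_cong)
next
  case (coord d f i)
  then obtain g where g: "\<And>j. polyfun (d - j) (g j)" "\<And>j x. j > d \<Longrightarrow> g j x = 0"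
    "\<And>x e. f (x + e *s y) = (\<Sum>j\<le>d. g j x * e ^ j)" by blast
  \<comment> \<open>Coefficient of \<open>e^j\<close> in the product of
    \<open>x $ i + e * y $ i\<close> with the expansion of \<open>f\<close>.\<close>
  define h where "h j = (\<lambda>x. x $ i * g j x + (if j = 0 then 0 else y $ i * g (j - 1) x))" for j
  show ?case
  proof (rule exI[of _ h], intro conjI allI impI)
    fix j
    have 1: "polyfun (Suc d - j) (\<lambda>x. x $ i * g j x)"
    proof (cases "j \<le> d")
      case True
      then show ?thesis using polyfun.coord[OF g(1)[of j], of i] by (simp add: Suc_diff_le)
    next
      case False
      then have "(\<lambda>x. x $ i * g j x) = (\<lambda>x. 0)" using g(2) by auto
      then show ?thesis by (simp add: polyfun.const)
    qed
    have 2: "polyfun (Suc d - j) (\<lambda>x. if j = 0 then 0 else y $ i * g (j - 1) x)"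
    proof (cases j)
      case (Suc j')
      then show ?thesis using polyfun_cmult[OF g(1)[of j'], of "y $ i"] by simp
    qed (auto intro: polyfun.const)
    show "polyfun (Suc d - j) (h j)" unfolding h_def by (rule polyfun.add[OF 1 2])
  next
    fix j x assume "j > Suc d"
    then show "h j x = 0" by (auto simp: h_def g(2))
  next
    fix x e
    have "(\<Sum>j\<le>Suc d. h j x * e ^ j)
        = (\<Sum>j\<le>Suc d. x $ i * g j x * e ^ j) + (\<Sum>j\<le>Suc d. (if j = 0 then 0 else y $ i * g (j - 1) x) * e ^ j)"
      unfolding h_def by (simp add: distrib_right sum.distrib del: sum.atMost_Suc)
    also have "(\<Sum>j\<le>Suc d. x $ i * g j x * e ^ j) = x $ i * (\<Sum>j\<le>d. g j x * e ^ j)"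
      by (simp add: g(2) sum_distrib_left mult.assoc)
    also have "(\<Sum>j\<le>Suc d. (if j = 0 then 0 else y $ i * g (j - 1) x) * e ^ j)
             = (\<Sum>j\<le>d. y $ i * g j x * e ^ Suc j)"
      by (subst sum.atMost_Suc_shift) simp
    also have "\<dots> = e * y $ i * (\<Sum>j\<le>d. g j x * e ^ j)"
      by (simp add: sum_distrib_left mult_ac)
    finally show "(x + e *s y) $ i * f (x + e *s y) = (\<Sum>j\<le>Suc d. h j x * e ^ j)"
      by (simp add: g(3) distrib_right)
  qed
next
  case (add d f1 f2)
  obtain g1 where g1: "\<And>j. polyfun (d - j) (g1 j)" "\<And>j x. j > d \<Longrightarrow> g1 j x = 0"
    "\<And>x e. f1 (x + e *s y) = (\<Sum>j\<le>d. g1 j x * e ^ j)" using add.IH(1) by blast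
  obtain g2 where g2: "\<And>j. polyfun (d - j) (g2 j)" "\<And>j x. j > d \<Longrightarrow> g2 j x = 0"
    "\<And>x e. f2 (x + e *s y) = (\<Sum>j\<le>d. g2 j x * e ^ j)" using add.IH(2) by blast
  show ?case
  proof (rule exI[of _ "\<lambda>j x. g1 j x + g2 j x"], intro conjI allI impI)
    show "polyfun (d - j) (\<lambda>x. g1 j x + g2 j x)" for j by (rule polyfun.add[OF g1(1) g2(1)])
    show "g1 j x + g2 j x = 0" if "j > d" for j x using that by (simp add: g1(2) g2(2))
    show "f1 (x + e *s y) + f2 (x + e *s y) = (\<Sum>j\<le>d. (g1 j x + g2 j x) * e ^ j)" for x e
      by (simp add: g1(3) g2(3) distrib_right sum.distrib)
  qed
qed

section \<open>Restricting a polynomial to a line\<close>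

lemma poly_eqI_infinite:
  fixes p q :: "'k::field poly"
  assumes "infinite (UNIV :: 'k set)" "\<And>x. poly p x = poly q x"
  shows "p = q"
proof (rule ccontr)
  assume "p \<noteq> q"
  then have "finite {x. poly (p - q) x = 0}" by (intro poly_roots_finite) simp
  then show False using assms by simp
qed

definition along :: "('k::field^'n \<Rightarrow> 'k) \<Rightarrow> 'k^'n \<Rightarrow> 'k^'n \<Rightarrow> 'k poly" where
  "along f x y = (THE p. \<forall>e. poly p e = f (x + e *s y))"

text \<open>A coefficient of the restriction to a line instead of an iterated derivative: in
  characteristic \<open>p\<close> the factor \<open>j!\<close> would destroy the information for
  \<open>j \<ge> p\<close>.\<close>

definition hasse :: "'k::field^'n \<Rightarrow> nat \<Rightarrow> ('k^'n \<Rightarrow> 'k) \<Rightarrow> 'k^'n \<Rightarrow> 'k" where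
  "hasse y j f x = coeff (along f x y) j"

lemma along_unique:
  fixes f :: "'k::field^'n \<Rightarrow> 'k"
  assumes "infinite (UNIV :: 'k set)" "\<And>e. poly p e = f (x + e *s y)"
  shows "along f x y = p"
  unfolding along_def
proof (rule the_equality)
  show "\<forall>e. poly p e = f (x + e *s y)" using assms by simp
next
  fix r assume "\<forall>e. poly r e = f (x + e *s y)"
  then show "r = p" using poly_eqI_infinite assms by metis
qed

text \<open>The exponents \<open>w a\<close> may coincide. This lets coefficients be read off from
  double sums and from sums over multi-indices, where many terms share one total degree.\<close>

lemma hasse_eqI:
  fixes f :: "'k::field^'n \<Rightarrow> 'k"
  assumes inf: "infinite (UNIV :: 'k set)" and fin: "finite A"
    and "\<And>e. f (x + e *s y) = (\<Sum>a\<in>A. c a * e ^ w a)"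
  shows "hasse y j f x = (\<Sum>a\<in>A. if w a = j then c a else 0)"
proof -
  have "along f x y = (\<Sum>a\<in>A. monom (c a) (w a))"
    by (rule along_unique[OF inf]) (simp add: assms(3) poly_sum poly_monom)
  then show ?thesis by (simp add: hasse_def coeff_sum)
qed

lemma polyfun_hasse:
  fixes f :: "'k::field^'n \<Rightarrow> 'k"
  assumes inf: "infinite (UNIV :: 'k set)" and f: "polyfun d f"
  shows "polyfun (d - j) (hasse y j f)" "d < j \<Longrightarrow> hasse y j f x = 0"
    "f (x + e *s y) = (\<Sum>j\<le>d. hasse y j f x * e ^ j)"
    "poly (along f x y) e = f (x + e *s y)"
proof -
  obtain g where g: "\<And>j. polyfun (d - j) (g j)" "\<And>j x. j > d \<Longrightarrow> g j x = 0"
    "\<And>x e. f (x + e *s y) = (\<Sum>j\<le>d. g j x * e ^ j)"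
    using polyfun_taylor[OF f, of y] by blast
  have eq: "hasse y j f = g j" for j
  proof
    fix x
    show "hasse y j f x = g j x"
      using hasse_eqI[where f = f and x = x and y = y and A = "{..d}" and c = "\<lambda>j. g j x" and w = id, OF inf _ , of j] g(2)[of j x]
      by (auto simp: g(3) not_le)
  qed
  show "polyfun (d - j) (hasse y j f)" "d < j \<Longrightarrow> hasse y j f x = 0"
    "f (x + e *s y) = (\<Sum>j\<le>d. hasse y j f x * e ^ j)"
    using g by (auto simp: eq)
  have "along f x y = (\<Sum>j\<le>d. monom (g j x) j)"
    by (rule along_unique[OF inf]) (simp add: g(3) poly_sum poly_monom)
  then show "poly (along f x y) e = f (x + e *s y)"
    by (simp add: g(3) poly_sum poly_monom)
qed

lemma hasse_expand2:
  fixes f :: "'k::field^'n \<Rightarrow> 'k"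
  assumes inf: "infinite (UNIV :: 'k set)" and f: "polyfun d f"
  shows "f (x + s *s z + t *s y) = (\<Sum>j\<le>d. \<Sum>i\<le>d. hasse z i (hasse y j f) x * s ^ i * t ^ j)"
proof -
  have "f (x + s *s z + t *s y) = (\<Sum>j\<le>d. hasse y j f (x + s *s z) * t ^ j)"
    by (rule polyfun_hasse(3)[OF inf f])
  also have "\<dots> = (\<Sum>j\<le>d. \<Sum>i\<le>d. hasse z i (hasse y j f) x * s ^ i * t ^ j)"
  proof (intro sum.cong refl)
    fix j
    have "polyfun d (hasse y j f)"
      using polyfun_hasse(1)[OF inf f] polyfun_mono by (metis diff_le_self)
    from polyfun_hasse(3)[OF inf this]
    show "hasse y j f (x + s *s z) * t ^ j = (\<Sum>i\<le>d. hasse z i (hasse y j f) x * s ^ i * t ^ j)"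
      by (simp add: sum_distrib_right)
  qed
  finally show ?thesis .
qed

text \<open>Both sides are the coefficient of \<open>s^i t^j\<close> in
  \<open>f (x + s *s z + t *s y)\<close>. The expansion with the directions exchanged is compared as
  a polynomial in \<open>t\<close>, then in \<open>s\<close>.\<close>

lemma hasse_commute:
  fixes f :: "'k::field^'n \<Rightarrow> 'k"
  assumes inf: "infinite (UNIV :: 'k set)" and f: "polyfun d f"
  shows "hasse z i (hasse y j f) x = hasse y j (hasse z i f) x"
proof -
  have pd: "polyfun d (hasse v m f)" for v m
    using polyfun_hasse(1)[OF inf f] polyfun_mono by (metis diff_le_self)
  have eq: "hasse y j f (x + s *s z) = (\<Sum>i\<le>d. hasse y j (hasse z i f) x * s ^ i)" for s
  proof -
    have "f ((x + s *s z) + t *s y) = (\<Sum>j\<le>d. (\<Sum>i\<le>d. hasse y j (hasse z i f) x * s ^ i) * t ^ j)" for t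
      using hasse_expand2[OF inf f, of x t y s z]
      by (subst (asm) sum.swap) (simp add: sum_distrib_left sum_distrib_right algebra_simps)
    from hasse_eqI[OF inf _ this, of j]
    have *: "hasse y j f (x + s *s z)
       = (\<Sum>j'\<le>d. if j' = j then (\<Sum>i\<le>d. hasse y j' (hasse z i f) x * s ^ i) else 0)" by simp
    show ?thesis
    proof (cases "j \<le> d")
      case True
      then show ?thesis using * by simp
    next
      case False
      then show ?thesis using polyfun_hasse(2)[OF inf f] polyfun_hasse(2)[OF inf pd] by simp
    qed
  qed
  show ?thesis
  proof (cases "i \<le> d")
    case True
    with hasse_eqI[OF inf _ eq, of i] show ?thesis by simp
  next
    case False
    then have "hasse z i f = (\<lambda>x. 0)" using polyfun_hasse(2)[OF inf f] by auto
    moreover have "hasse y j (\<lambda>x. 0) x = 0"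
      using hasse_eqI[OF inf, of "{}" "\<lambda>x. 0" x y] by simp
    ultimately show ?thesis using False polyfun_hasse(2)[OF inf pd] by simp
  qed
qed

text \<open>Collect the terms \<open>s^(i+j)\<close> of the two-variable expansion. As a polynomial
  in \<open>c\<close> the left side has the mixed derivatives as coefficients; this serves to pass
  from pure to mixed derivatives and, at top order, to expand the leading form.\<close>

lemma hasse_mixed_direction:
  fixes f :: "'k::field^'n \<Rightarrow> 'k"
  assumes inf: "infinite (UNIV :: 'k set)" and f: "polyfun d f" and w: "w \<le> d"
  shows "hasse (z + c *s y) w f x = (\<Sum>j\<le>w. hasse z (w - j) (hasse y j f) x * c ^ j)"
proof -
  define h where "h i j = hasse z i (hasse y j f) x" for i j
  have "f (x + s *s (z + c *s y)) = (\<Sum>(j,i)\<in>{..d}\<times>{..d}. (h i j * c ^ j) * s ^ (i + j))" for s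
  proof -
    have "x + s *s (z + c *s y) = x + s *s z + (s * c) *s y"
      by (simp add: vector_add_ldistrib vector_smult_assoc add.assoc)
    then have "f (x + s *s (z + c *s y)) = (\<Sum>j\<le>d. \<Sum>i\<le>d. h i j * s ^ i * (s * c) ^ j)"
      by (simp only: hasse_expand2[OF inf f] h_def)
    also have "\<dots> = (\<Sum>j\<le>d. \<Sum>i\<le>d. (h i j * c ^ j) * s ^ (i + j))"
      by (intro sum.cong refl) (simp add: power_mult_distrib power_add)
    finally show ?thesis by (simp only: sum.cartesian_product)
  qed
  then have "f (x + s *s (z + c *s y)) = (\<Sum>a\<in>{..d}\<times>{..d}. (h (snd a) (fst a) * c ^ fst a) * s ^ (snd a + fst a))" for s
    by (simp add: case_prod_beta)
  from hasse_eqI[OF inf _ this, of w]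
  have "hasse (z + c *s y) w f x = (\<Sum>j\<le>d. \<Sum>i\<le>d. if i + j = w then h i j * c ^ j else 0)"
    by (simp add: sum.cartesian_product case_prod_beta)
  also have "\<dots> = (\<Sum>j\<le>d. if j \<le> w then h (w - j) j * c ^ j else 0)"
  proof (intro sum.cong refl)
    fix j
    have "(\<Sum>i\<le>d. if i + j = w then h i j * c ^ j else 0)
        = (\<Sum>i\<le>d. if i = w - j then (if j \<le> w then h i j * c ^ j else 0) else 0)"
      by (intro sum.cong) auto
    also have "\<dots> = (if j \<le> w then h (w - j) j * c ^ j else 0)"
      using w by (auto simp: sum.delta)
    finally show "(\<Sum>i\<le>d. if i + j = w then h i j * c ^ j else 0) = (if j \<le> w then h (w - j) j * c ^ j else 0)" .
  qed
  also have "\<dots> = (\<Sum>j\<in>{..d} \<inter> {..w}. h (w - j) j * c ^ j)"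
    by (subst sum.inter_restrict) auto
  also have "{..d} \<inter> {..w} = {..w}" using w by auto
  finally show ?thesis by (simp add: h_def)
qed

section \<open>The Schwartz--Zippel lemma with multiplicities\<close>

text \<open>Only pure directional derivatives are required; mixed ones follow by
  \<open>vanishes_to_order_hasse\<close>. Restricting the directions to \<open>U\<close> suits an
  induction on the dimension of a flat.\<close>

definition vanishes_to_order :: "('k::field^'n) set \<Rightarrow> ('k^'n \<Rightarrow> 'k) \<Rightarrow> 'k^'n \<Rightarrow> nat \<Rightarrow> bool" where
  "vanishes_to_order U f x N \<longleftrightarrow> (\<forall>y\<in>U. \<forall>j<N. hasse y j f x = 0)"

text \<open>The derivative of order \<open>i + j\<close> in direction \<open>z + c *s y\<close>
  vanishes for all \<open>c\<close>; it is a polynomial in \<open>c\<close> whose coefficient at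
  \<open>c^j\<close> is the mixed derivative, and a polynomial with infinitely many zeros is zero.
  So a derivative of order \<open>j\<close> lowers the order of vanishing by at most
  \<open>j\<close>.\<close>

lemma vanishes_to_order_hasse:
  fixes f :: "'k::field^'n \<Rightarrow> 'k"
  assumes inf: "infinite (UNIV :: 'k set)" and f: "polyfun d f"
    and U: "vec.subspace U" and ord: "vanishes_to_order U f x N" and "y \<in> U" "z \<in> U" and ij: "i + j < N"
  shows "hasse z i (hasse y j f) x = 0"
proof (cases "i + j \<le> d")
  case True
  define w where "w = i + j"
  define p where "p = (\<Sum>j\<le>w. monom (hasse z (w - j) (hasse y j f) x) j)"
  have "poly p c = 0" for c
  proof -
    have "poly p c = hasse (z + c *s y) w f x"
      using True by (subst hasse_mixed_direction[OF inf f]) (auto simp: w_def p_def poly_sum poly_monom)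
    also have "\<dots> = 0"
      using ord ij assms by (auto simp: vanishes_to_order_def w_def vec.subspace_add vec.subspace_scale)
    finally show ?thesis .
  qed
  then have "p = 0" by (intro poly_eqI_infinite[OF inf]) simp
  then have "coeff p j = 0" by simp
  then show ?thesis by (simp add: p_def coeff_sum w_def)
next
  case False
  have pd: "polyfun (d - j) (hasse y j f)" using polyfun_hasse(1)[OF inf f] .
  show ?thesis
  proof (cases "j \<le> d")
    case True
    with False have "d - j < i" by linarith
    then show ?thesis using polyfun_hasse(2)[OF inf pd] by blast
  next
    case jd: False
    then have "hasse y j f = (\<lambda>x. 0)" using polyfun_hasse(2)[OF inf f] by auto
    then show ?thesis using hasse_eqI[OF inf, of "{}" "\<lambda>x. 0" x z] by simp
  qed
qed

text \<open>Recentred at \<open>x + t *s e\<close>, the restriction is divisible by the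
  \<open>N\<close>-th power of its variable; substituting back moves the zero to
  \<open>t\<close>.\<close>

lemma root_power_dvd_along:
  fixes f :: "'k::field^'n \<Rightarrow> 'k"
  assumes inf: "infinite (UNIV :: 'k set)" and f: "polyfun d f"
    and "\<And>i. i < N \<Longrightarrow> hasse e i f (x + t *s e) = 0"
  shows "[:-t, 1:] ^ N dvd along f x e"
proof -
  have "monom 1 N dvd along f (x + t *s e) e"
    using assms(3) by (simp add: monom_1_dvd_iff' hasse_def)
  then obtain r where r: "along f (x + t *s e) e = monom 1 N * r" by blast
  have "along f x e = pcompose (along f (x + t *s e) e) [:-t, 1:]"
  proof (rule along_unique[OF inf])
    fix s
    have "x + t *s e + (s - t) *s e = x + s *s e" by (simp add: vec.scale_left_diff_distrib)
    then show "poly (pcompose (along f (x + t *s e) e) [:-t, 1:]) s = f (x + s *s e)"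
      by (simp add: poly_pcompose polyfun_hasse(4)[OF inf f])
  qed
  also have "\<dots> = [:-t, 1:] ^ N * pcompose r [:-t, 1:]"
  proof -
    have "pcompose (monom 1 N) [:-t, 1:] = [:-t, 1:] ^ N"
      by (rule poly_eqI_infinite[OF inf]) (simp add: poly_pcompose poly_monom)
    then show ?thesis by (simp add: r pcompose_mult)
  qed
  finally show ?thesis by simp
qed

lemma sum_root_multiplicities_le_degree:
  fixes p :: "'k::field poly"
  assumes "finite T" "p \<noteq> 0" "\<And>t. t \<in> T \<Longrightarrow> [:-t, 1:] ^ m t dvd p"
  shows "(\<Sum>t\<in>T. m t) \<le> degree p"
  using assms
proof (induction T arbitrary: p rule: finite_induct)
  case (insert t T)
  from insert.prems obtain r where r: "p = [:-t, 1:] ^ m t * r" by blast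
  have "r \<noteq> 0" using insert.prems r by auto
  have "[:-s, 1:] ^ m s dvd r" if "s \<in> T" for s
  proof -
    have "order s ([:-t, 1:] ^ m t) = 0"
      using that insert.hyps by (intro order_0I) auto
    then have "order s p = order s r"
      using insert.prems r by (simp add: order_mult)
    then show ?thesis
      using insert.prems(1) insert.prems(2)[of s] that by (simp add: order_divides \<open>r \<noteq> 0\<close>)
  qed
  then have "sum m T \<le> degree r" using insert.IH \<open>r \<noteq> 0\<close> by blast
  moreover have "degree p = m t + degree r"
    unfolding r using \<open>r \<noteq> 0\<close> by (subst degree_mult_eq) (auto simp: degree_linear_power)
  ultimately show ?case using insert.hyps by simp
qed simp

text \<open>Sum over the formal grid of points \<open>x + t1 e1 + ... + tr er\<close> with all
  \<open>ti\<close> in \<open>T\<close>. A point counts once per representation, so the directions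
  may be linearly dependent.\<close>

primrec gridsum :: "'k::field set \<Rightarrow> ('k^'n) list \<Rightarrow> ('k^'n \<Rightarrow> nat) \<Rightarrow> 'k^'n \<Rightarrow> nat" where
  "gridsum T [] m x = m x"
| "gridsum T (e # es) m x = (\<Sum>t\<in>T. gridsum T es m (x + t *s e))"

lemma gridsum_sum:
  "finite A \<Longrightarrow> gridsum T es (\<lambda>x. \<Sum>a\<in>A. m a x) x = (\<Sum>a\<in>A. gridsum T es (m a) x)"
  by (induction es arbitrary: x) (auto intro: sum.swap)

lemma gridsum_shift: "gridsum T es (\<lambda>x. m (x + v)) x = gridsum T es m (x + v)"
  by (induction es arbitrary: x) (simp_all add: add_ac)

lemma gridsum_Cons:
  assumes "finite T"
  shows "gridsum T (e # es) m x = gridsum T es (\<lambda>x. \<Sum>t\<in>T. m (x + t *s e)) x"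
  by (simp add: gridsum_sum[OF assms] gridsum_shift)

lemma gridsum_mono:
  assumes "\<And>y. y \<in> vec.span (set es) \<Longrightarrow> m (x + y) \<le> m' (x + y)"
  shows "gridsum T es m x \<le> gridsum T es m' x"
  using assms
proof (induction es arbitrary: x)
  case Nil
  then show ?case using Nil[of 0] by (simp add: vec.span_zero)
next
  case (Cons e es)
  have "gridsum T es m (x + t *s e) \<le> gridsum T es m' (x + t *s e)" for t
  proof (rule Cons.IH)
    fix y assume "y \<in> vec.span (set es)"
    then have "t *s e + y \<in> vec.span (set (e # es))"
      using vec.span_mono[of "set es" "set (e # es)"]
      by (intro vec.span_add vec.span_scale) (auto intro: vec.span_base)
    from Cons.prems[OF this] show "m (x + t *s e + y) \<le> m' (x + t *s e + y)"
      by (simp add: add.assoc)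
  qed
  then show ?case by (simp add: sum_mono)
qed

lemma gridsum_linear:
  "gridsum T es (\<lambda>x. c * m x + b) x = c * gridsum T es m x + b * card T ^ length es"
  by (induction es arbitrary: x) (simp_all add: sum.distrib sum_distrib_left mult_ac)

text \<open>The usual \<open>\<Sum> m \<le> d |T|^(n-1)\<close> is multiplied by \<open>|T|\<close> to avoid the truncated exponent at \<open>n = 0\<close>.\<close>

theorem schwartz_zippel_multiplicity:
  fixes f :: "'k::field^'n \<Rightarrow> 'k"
  assumes inf: "infinite (UNIV :: 'k set)" and T: "finite T" and f: "polyfun d f"
    and "\<And>y. y \<in> vec.span (set es) \<Longrightarrow> vanishes_to_order (vec.span (set es)) f (x + y) (m (x + y))"
    and "\<exists>y\<in>vec.span (set es). f (x + y) \<noteq> 0"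
  shows "card T * gridsum T es m x \<le> d * card T ^ length es"
  using assms(3-)
proof (induction es arbitrary: d f m)
  case Nil
  have "m x = 0"
  proof (rule ccontr)
    assume "m x \<noteq> 0"
    then have "hasse 0 0 f x = 0" using Nil.prems(2)[of 0] by (auto simp: vanishes_to_order_def)
    moreover have "hasse 0 0 f x = f x"
      using polyfun_hasse(3)[OF inf Nil.prems(1), of x 0 0] by (simp add: power_0_left if_distrib cong: if_cong)
    ultimately show False using Nil.prems(3) by simp
  qed
  then show ?case by simp
next
  case (Cons e es)
  let ?U = "vec.span (set es)" and ?V = "vec.span (set (e # es))"
  note f = Cons.prems(1)
  have UV: "?U \<subseteq> ?V" by (rule vec.span_mono) auto
  have eV: "e \<in> ?V" by (rule vec.span_base) simp
  \<comment> \<open>\<open>J\<close> is the degree of \<open>f\<close> in direction \<open>e\<close>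
    over the flat \<open>x + ?U\<close>. Its leading coefficient there, \<open>g\<close> below, is
    not identically zero on that flat and has degree at most \<open>d - J\<close>.\<close>
  define J where "J = Max {j. \<exists>y\<in>?U. hasse e j f (x + y) \<noteq> 0}"
  have J_fin: "finite {j. \<exists>y\<in>?U. hasse e j f (x + y) \<noteq> 0}"
    by (rule finite_subset[of _ "{..d}"]) (use polyfun_hasse(2)[OF inf f] in \<open>auto simp: not_le[symmetric]\<close>)
  have "{j. \<exists>y\<in>?U. hasse e j f (x + y) \<noteq> 0} \<noteq> {}"
  proof
    assume a: "{j. \<exists>y\<in>?U. hasse e j f (x + y) \<noteq> 0} = {}"
    obtain v where v: "v \<in> ?V" "f (x + v) \<noteq> 0" using Cons.prems(3) by blast
    obtain c where c: "v - c *s e \<in> ?U" using v(1) by (auto simp: vec.span_breakdown_eq)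
    have "f (x + (v - c *s e) + c *s e) = 0"
      unfolding polyfun_hasse(3)[OF inf f] using a c by auto
    then show False using v by (simp add: add.assoc)
  qed
  then have J: "\<exists>y\<in>?U. hasse e J f (x + y) \<noteq> 0"
    using Max_in[OF J_fin] unfolding J_def by blast
  have J_max: "hasse e j f (x + y) = 0" if "j > J" "y \<in> ?U" for j y
    using that Max_ge[OF J_fin, of j] unfolding J_def by force
  have Jd: "J \<le> d" using J polyfun_hasse(2)[OF inf f] not_le by metis
  define g where "g = hasse e J f"
  have g: "polyfun (d - J) g" unfolding g_def by (rule polyfun_hasse(1)[OF inf f])
  obtain y0 where y0: "y0 \<in> ?U" "g (x + y0) \<noteq> 0" using J g_def by blast
  \<comment> \<open>The exact order of vanishing of \<open>g\<close> within the smaller flat. It is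
    an admissible multiplicity for the induction hypothesis, and at each point of the flat some
    derivative of \<open>g\<close> of exactly this order survives.\<close>
  define m' where "m' z = (LEAST j. \<exists>y\<in>?U. hasse y j g z \<noteq> 0)" for z
  have m'_ex: "\<exists>y\<in>?U. hasse y (m' (x + y1)) g (x + y1) \<noteq> 0" if y1: "y1 \<in> ?U" for y1
  proof -
    have "\<exists>j. \<exists>y\<in>?U. hasse y j g (x + y1) \<noteq> 0"
    proof (rule ccontr)
      assume a: "\<nexists>j. \<exists>y\<in>?U. hasse y j g (x + y1) \<noteq> 0"
      have "y0 - y1 \<in> ?U" using y0 y1 by (simp add: vec.span_diff)
      then have "g (x + y1 + 1 *s (y0 - y1)) = 0"
        unfolding polyfun_hasse(3)[OF inf g] using a by auto
      then show False using y0 by (simp add: add.assoc)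
    qed
    then show ?thesis unfolding m'_def by (rule LeastI_ex)
  qed
  have IH: "card T * gridsum T es m' x \<le> (d - J) * card T ^ length es"
  proof (rule Cons.IH[OF g])
    fix y assume "y \<in> ?U"
    show "vanishes_to_order ?U g (x + y) (m' (x + y))"
      unfolding vanishes_to_order_def m'_def using not_less_Least by blast
  qed (use y0 in blast)
  have le: "(\<Sum>t\<in>T. m (x + y1 + t *s e)) \<le> card T * m' (x + y1) + J" if y1: "y1 \<in> ?U" for y1
  proof -
    let ?x = "x + y1"
    let ?m = "m' ?x"
    obtain y where y: "y \<in> ?U" "hasse y ?m g ?x \<noteq> 0" using m'_ex[OF y1] by blast
    \<comment> \<open>On the line through \<open>?x\<close> in direction \<open>e\<close>, this
      derivative has degree at most \<open>J\<close> and a nonzero coefficient at \<open>J\<close>,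
      inherited from \<open>g\<close>. A point of order \<open>m\<close> for \<open>f\<close>
      remains a root of multiplicity at least \<open>m - ?m\<close>, so these differences sum to at
      most \<open>J\<close>.\<close>
    define h where "h = hasse y ?m f"
    have h: "polyfun (d - ?m) h" unfolding h_def by (rule polyfun_hasse(1)[OF inf f])
    let ?p = "along h ?x e"
    have co: "coeff ?p i = hasse y ?m (hasse e i f) ?x" for i
      using hasse_commute[OF inf f] unfolding h_def by (simp add: hasse_def[of e i])
    have "coeff ?p J \<noteq> 0" using y by (simp add: co g_def)
    then have p0: "?p \<noteq> 0" by auto
    have "coeff ?p i = 0" if i: "i > J" for i
    proof -
      have "hasse e i f (?x + s *s y) = 0" for s
        using J_max[OF i, of "y1 + s *s y"] y(1) y1
        by (simp add: vec.span_add vec.span_scale add.assoc)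
      then have "along (hasse e i f) ?x y = 0" by (intro along_unique[OF inf]) simp
      then show ?thesis by (simp add: co hasse_def[of y])
    qed
    then have deg: "degree ?p \<le> J" by (intro degree_le) auto
    have "(\<Sum>t\<in>T. m (?x + t *s e) - ?m) \<le> degree ?p"
    proof (rule sum_root_multiplicities_le_degree[OF T p0])
      fix t
      show "[:- t, 1:] ^ (m (?x + t *s e) - ?m) dvd ?p"
      proof (rule root_power_dvd_along[OF inf h])
        fix i assume i: "i < m (?x + t *s e) - ?m"
        have "y1 + t *s e \<in> ?V" using y1 UV eV by (auto intro: vec.span_add vec.span_scale)
        then have "vanishes_to_order ?V f (?x + t *s e) (m (?x + t *s e))"
          using Cons.prems(2) by (metis add.assoc)
        moreover have "y \<in> ?V" using y(1) UV by (rule subsetD[rotated])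
        moreover have "i + ?m < m (?x + t *s e)" using i by linarith
        ultimately show "hasse e i h (?x + t *s e) = 0"
          unfolding h_def by (intro vanishes_to_order_hasse[OF inf f vec.subspace_span _ _ eV])
      qed
    qed
    then have *: "(\<Sum>t\<in>T. m (?x + t *s e) - ?m) \<le> J" using deg by simp
    have "(\<Sum>t\<in>T. m (?x + t *s e)) \<le> (\<Sum>t\<in>T. ?m + (m (?x + t *s e) - ?m))"
      by (intro sum_mono) simp
    also have "\<dots> \<le> card T * ?m + J" using * by (simp add: sum.distrib)
    finally show ?thesis .
  qed
  have "gridsum T (e # es) m x \<le> card T * gridsum T es m' x + J * card T ^ length es"
    unfolding gridsum_Cons[OF T] gridsum_linear[symmetric]
    by (rule gridsum_mono) (use le in auto)
  also have "\<dots> \<le> (d - J) * card T ^ length es + J * card T ^ length es" using IH by simp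
  also have "\<dots> = d * card T ^ length es" using Jd by (simp add: distrib_right[symmetric])
  finally show ?case by (simp add: mult.left_commute)
qed

section \<open>Interpolation and the top-degree part\<close>

lemma homogeneous_system_nontrivial:
  fixes c :: "'b \<Rightarrow> 'a \<Rightarrow> 'k::field"
  assumes "finite B" "finite A" "card B < card A"
  shows "\<exists>v. (\<exists>a\<in>A. v a \<noteq> 0) \<and> (\<forall>b\<in>B. (\<Sum>a\<in>A. c b a * v a) = 0)"
  using assms
proof (induction B arbitrary: A c rule: finite_induct)
  case empty
  then have "A \<noteq> {}" by auto
  then show ?case by (intro exI[of _ "\<lambda>_. 1"]) auto
next
  case (insert b B)
  show ?case
  proof (cases "\<forall>a\<in>A. c b a = 0")
    case True
    have "card B < card A" using insert by simp
    from insert.IH[OF insert.prems(1) this] True show ?thesis by fastforce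
  next
    case False
    then obtain a0 where a0: "a0 \<in> A" "c b a0 \<noteq> 0" by blast
    let ?A = "A - {a0}"
    \<comment> \<open>Equation \<open>b\<close> is solved for the unknown \<open>a0\<close> and
      substituted into the others.\<close>
    define c' where "c' b' a = c b' a - c b' a0 * c b a / c b a0" for b' a
    have "card B < card ?A" using insert a0 by simp
    from insert.IH[OF _ this, of c'] insert.prems(1) obtain v where
      v: "\<exists>a\<in>?A. v a \<noteq> 0" "\<And>b'. b' \<in> B \<Longrightarrow> (\<Sum>a\<in>?A. c' b' a * v a) = 0" by auto
    define S where "S = (\<Sum>a\<in>?A. c b a * v a)"
    define w where "w = v(a0 := - S / c b a0)"
    have split: "(\<Sum>a\<in>A. c b' a * w a) = - c b' a0 * S / c b a0 + (\<Sum>a\<in>?A. c b' a * v a)" for b'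
      using insert.prems(1) a0(1) by (subst sum.remove[of A a0]) (auto simp: w_def intro!: sum.cong)
    have "(\<Sum>a\<in>A. c b' a * w a) = 0" if "b' \<in> B" for b'
    proof -
      have "0 = (\<Sum>a\<in>?A. c b' a * v a - c b' a0 / c b a0 * (c b a * v a))"
        unfolding v(2)[OF that, symmetric] c'_def by (intro sum.cong) (auto simp: algebra_simps)
      also have "\<dots> = (\<Sum>a\<in>?A. c b' a * v a) - c b' a0 / c b a0 * S"
        by (simp add: sum_subtractf S_def sum_distrib_left)
      finally show ?thesis by (simp add: split)
    qed
    moreover have "(\<Sum>a\<in>A. c b a * w a) = 0"
      unfolding split using a0(2) by (simp add: S_def)
    moreover have "\<exists>a\<in>A. w a \<noteq> 0" using v(1) by (auto simp: w_def)
    ultimately show ?thesis by blast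
  qed
qed

section \<open>Counting and collecting monomials\<close>

definition exponents :: "nat \<Rightarrow> ('n::finite \<Rightarrow> nat) set" where
  "exponents d = {\<alpha>. sum \<alpha> UNIV \<le> d}"

text \<open>Stars and bars: the slack \<open>d - sum \<alpha> UNIV\<close>, appended as a last
  entry, turns exponents of degree at most \<open>d\<close> into lists of length
  \<open>n + 1\<close> with sum exactly \<open>d\<close>.\<close>

lemma card_exponents: "card (exponents d :: ('n::finite \<Rightarrow> nat) set) = (d + CARD('n)) choose CARD('n)"
proof -
  let ?n = "CARD('n)"
  obtain h where h: "bij_betw h {..<?n} (UNIV :: 'n set)"
    using ex_bij_betw_nat_finite[of "UNIV :: 'n set"] by (auto simp: atLeast0LessThan)
  define g where "g = inv_into {..<?n} h"
  have hg: "h (g i) = i" "g i < ?n" for i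
    using h by (auto simp: g_def bij_betw_def f_inv_into_f intro: inv_into_into[of _ h "{..<?n}", simplified])
  have gh: "g (h k) = k" if "k < ?n" for k
    using h that by (auto simp: g_def bij_betw_def)
  have reidx: "(\<Sum>k<?n. \<beta> (h k)) = sum \<beta> UNIV" for \<beta> :: "'n \<Rightarrow> nat"
    using sum.reindex_bij_betw[OF h] .
  let ?L = "{l::nat list. length l = Suc ?n \<and> sum_list l = d}"
  have "bij_betw (\<lambda>\<alpha>. map (\<lambda>k. \<alpha> (h k)) [0..<?n] @ [d - sum \<alpha> UNIV]) (exponents d) ?L"
  proof (rule bij_betw_byWitness[where f' = "\<lambda>l i. l ! g i"])
    show "\<forall>\<alpha>\<in>exponents d. (\<lambda>i. (map (\<lambda>k. \<alpha> (h k)) [0..<?n] @ [d - sum \<alpha> UNIV]) ! g i) = \<alpha>"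
      by (auto simp: nth_append hg)
    have sum: "(\<Sum>i\<in>UNIV. l ! g i) = (\<Sum>k<?n. l ! k)" for l :: "nat list"
      unfolding reidx[symmetric] by (intro sum.cong) (auto simp: gh)
    have sl: "sum_list l = (\<Sum>k<?n. l ! k) + l ! ?n" if "length l = Suc ?n" for l :: "nat list"
      using that by (simp add: sum_list_sum_nth atLeast0LessThan)
    show "\<forall>l\<in>?L. map (\<lambda>k. l ! g (h k)) [0..<?n] @ [d - (\<Sum>i\<in>UNIV. l ! g i)] = l"
    proof
      fix l assume l: "l \<in> ?L"
      show "map (\<lambda>k. l ! g (h k)) [0..<?n] @ [d - (\<Sum>i\<in>UNIV. l ! g i)] = l"
      proof (rule nth_equalityI)
        fix k assume "k < length (map (\<lambda>k. l ! g (h k)) [0..<?n] @ [d - (\<Sum>i\<in>UNIV. l ! g i)])"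
        then consider "k < ?n" | "k = ?n" by fastforce
        then show "(map (\<lambda>k. l ! g (h k)) [0..<?n] @ [d - (\<Sum>i\<in>UNIV. l ! g i)]) ! k = l ! k"
          by cases (use l sl[of l] in \<open>auto simp: nth_append gh sum\<close>)
      qed (use l in auto)
    qed
    show "(\<lambda>\<alpha>. map (\<lambda>k. \<alpha> (h k)) [0..<?n] @ [d - sum \<alpha> UNIV]) ` exponents d \<subseteq> ?L"
    proof safe
      fix \<alpha> :: "'n \<Rightarrow> nat" assume "\<alpha> \<in> exponents d"
      moreover have "sum_list (map (\<lambda>k. \<alpha> (h k)) [0..<?n]) = sum \<alpha> UNIV"
        by (simp add: interv_sum_list_conv_sum_set_nat atLeast0LessThan reidx)
      ultimately show "sum_list (map (\<lambda>k. \<alpha> (h k)) [0..<?n] @ [d - sum \<alpha> UNIV]) = d"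
        by (simp add: exponents_def)
    qed auto
    show "(\<lambda>l i. l ! g i) ` ?L \<subseteq> exponents d"
      using sl by (auto simp: exponents_def sum)
  qed
  then have "card (exponents d :: ('n \<Rightarrow> nat) set) = card ?L" by (rule bij_betw_same_card)
  also have "\<dots> = (d + ?n) choose d" by (subst card_length_sum_list) simp
  also have "\<dots> = (d + ?n) choose ?n" using binomial_symmetric[of d "d + ?n"] by simp
  finally show ?thesis .
qed

lemma finite_exponents [simp]: "finite (exponents d :: ('n::finite \<Rightarrow> nat) set)"
proof (rule card_ge_0_finite)
  show "0 < card (exponents d :: ('n::finite \<Rightarrow> nat) set)" unfolding card_exponents by simp
qed

lemma binomial_lower_power: "(d + 1) ^ n \<le> ((d + n) choose n) * fact n"
proof (induction n)
  case (Suc n)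
  have "Suc n * ((d + Suc n) choose Suc n) = (d + Suc n) * ((d + n) choose n)"
    using Suc_times_binomial[of n "d + n"] by simp
  then have "((d + Suc n) choose Suc n) * fact (Suc n) = (d + Suc n) * (((d + n) choose n) * fact n)"
    by (metis (no_types, lifting) fact_Suc mult.assoc mult.commute of_nat_id)
  moreover have "(d + 1) * (d + 1) ^ n \<le> (d + Suc n) * (((d + n) choose n) * fact n)"
    by (rule mult_mono[OF _ Suc]) auto
  ultimately show ?case by simp
qed simp

definition monomial :: "('n::finite \<Rightarrow> nat) \<Rightarrow> 'k::field^'n \<Rightarrow> 'k" where
  "monomial \<alpha> x = (\<Prod>i\<in>UNIV. (x $ i) ^ \<alpha> i)"

lemma polyfun_monomial: "sum \<alpha> UNIV \<le> d \<Longrightarrow> polyfun d (monomial \<alpha>)"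
proof -
  have "polyfun (sum \<alpha> I) (\<lambda>x. \<Prod>i\<in>I. (x $ i) ^ \<alpha> i)" for I
  proof (induction I rule: infinite_finite_induct)
    case (insert i I)
    then show ?case using polyfun_coord_power[OF insert.IH, of "\<alpha> i" i] by simp
  qed (auto intro: polyfun.const)
  from this[of UNIV] show "sum \<alpha> UNIV \<le> d \<Longrightarrow> polyfun d (monomial \<alpha>)"
    unfolding monomial_def[abs_def] by (rule polyfun_mono)
qed

lemma collect_monomials:
  assumes "finite A" "e ` A \<subseteq> exponents d"
  shows "\<exists>c'. \<forall>x. (\<Sum>a\<in>A. c a * monomial (e a) x) = (\<Sum>\<alpha>\<in>exponents d. c' \<alpha> * monomial \<alpha> x)"
proof (intro exI allI)
  fix x
  have "(\<Sum>a\<in>A. c a * monomial (e a) x)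
      = (\<Sum>\<alpha>\<in>exponents d. \<Sum>a\<in>{a\<in>A. e a = \<alpha>}. c a * monomial (e a) x)"
    by (rule sum.group[symmetric, OF assms(1) finite_exponents assms(2)])
  also have "\<dots> = (\<Sum>\<alpha>\<in>exponents d. (\<Sum>a\<in>{a\<in>A. e a = \<alpha>}. c a) * monomial \<alpha> x)"
    by (simp add: sum_distrib_right)
  finally show "(\<Sum>a\<in>A. c a * monomial (e a) x)
      = (\<Sum>\<alpha>\<in>exponents d. (\<Sum>a\<in>{a\<in>A. e a = \<alpha>}. c a) * monomial \<alpha> x)" .
qed

lemma polyfun_coefficients:
  "polyfun d f \<Longrightarrow> \<exists>c. \<forall>x. f x = (\<Sum>\<alpha>\<in>exponents d. c \<alpha> * monomial \<alpha> x)"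
proof (induction rule: polyfun.induct)
  case (const d c)
  show ?case
    using collect_monomials[of "{()}" "\<lambda>_ _. 0" d "\<lambda>_. c"] by (simp add: exponents_def monomial_def)
next
  case (coord d f i)
  then obtain c where c: "\<And>x. f x = (\<Sum>\<alpha>\<in>exponents d. c \<alpha> * monomial \<alpha> x)" by blast
  have up: "x $ i * monomial \<alpha> x = monomial (\<alpha>(i := Suc (\<alpha> i))) x" for \<alpha> and x :: "'a^'b"
    by (simp add: monomial_def prod.remove[of UNIV i] mult_ac)
  have "(\<lambda>\<alpha>. \<alpha>(i := Suc (\<alpha> i))) ` exponents d \<subseteq> exponents (Suc d)"
    by (auto simp: exponents_def sum.remove[of UNIV i])
  from collect_monomials[OF finite_exponents this, of c]
  show ?case by (simp add: c sum_distrib_left mult.left_commute up)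
next
  case (add d f g)
  then obtain c1 c2 where "\<And>x. f x = (\<Sum>\<alpha>\<in>exponents d. c1 \<alpha> * monomial \<alpha> x)"
    "\<And>x. g x = (\<Sum>\<alpha>\<in>exponents d. c2 \<alpha> * monomial \<alpha> x)" by blast
  then have "\<forall>x. f x + g x = (\<Sum>\<alpha>\<in>exponents d. (c1 \<alpha> + c2 \<alpha>) * monomial \<alpha> x)"
    by (simp add: distrib_right sum.distrib)
  then show ?case by (rule exI[of _ "\<lambda>\<alpha>. c1 \<alpha> + c2 \<alpha>"])
qed

lemma digits_unique:
  fixes a b :: "nat \<Rightarrow> nat"
  assumes "\<And>k. k < n \<Longrightarrow> a k < N" "\<And>k. k < n \<Longrightarrow> b k < N"
    "(\<Sum>k<n. a k * N ^ k) = (\<Sum>k<n. b k * N ^ k)" "k < n"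
  shows "a k = b k"
  using assms
proof (induction n arbitrary: a b k)
  case (Suc n)
  have s: "(\<Sum>k<Suc n. a k * N ^ k) = a 0 + N * (\<Sum>k<n. a (Suc k) * N ^ k)" for a :: "nat \<Rightarrow> nat"
    by (subst sum.lessThan_Suc_shift) (simp add: sum_distrib_left mult_ac)
  have eq: "a 0 + N * (\<Sum>k<n. a (Suc k) * N ^ k) = b 0 + N * (\<Sum>k<n. b (Suc k) * N ^ k)"
    using Suc.prems(3) unfolding s .
  have lt: "a 0 < N" "b 0 < N" using Suc.prems by auto
  have 0: "a 0 = b 0" using arg_cong[OF eq, of "\<lambda>x. x mod N"] lt by simp
  with eq lt have "(\<Sum>k<n. a (Suc k) * N ^ k) = (\<Sum>k<n. b (Suc k) * N ^ k)" by simp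
  then have IH: "a (Suc k) = b (Suc k)" if "k < n" for k
    using Suc.IH[of "\<lambda>k. a (Suc k)" "\<lambda>k. b (Suc k)" k] Suc.prems(1,2) that by blast
  show ?case
  proof (cases k)
    case (Suc k')
    then show ?thesis using IH[of k'] \<open>k < Suc n\<close> by simp
  qed (simp add: 0)
qed simp

text \<open>Kronecker substitution: on the curve whose coordinates are \<open>\<theta>\<close> raised to powers of a large
  \<open>N\<close>, distinct monomials become distinct powers of \<open>\<theta>\<close>.\<close>

lemma monomials_independent:
  fixes c :: "('n::finite \<Rightarrow> nat) \<Rightarrow> 'k::field"
  assumes inf: "infinite (UNIV :: 'k set)" and A: "finite A"
    and zero: "\<And>x :: 'k^'n. (\<Sum>\<alpha>\<in>A. c \<alpha> * monomial \<alpha> x) = 0" and "\<alpha> \<in> A"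
  shows "c \<alpha> = 0"
proof -
  let ?n = "CARD('n)"
  obtain h where h: "bij_betw h {..<?n} (UNIV :: 'n set)"
    using ex_bij_betw_nat_finite[of "UNIV :: 'n set"] by (auto simp: atLeast0LessThan)
  define g where "g = inv_into {..<?n} h"
  have gh: "g (h k) = k" if "k < ?n" for k
    using h that by (auto simp: g_def bij_betw_def)
  define N where "N = Suc (\<Sum>\<alpha>\<in>A. sum \<alpha> UNIV)"
  have N: "\<beta> i < N" if "\<beta> \<in> A" for \<beta> i
  proof -
    have "\<beta> i \<le> sum \<beta> UNIV" by (rule member_le_sum) auto
    also have "\<dots> \<le> (\<Sum>\<alpha>\<in>A. sum \<alpha> UNIV)" using that A by (intro member_le_sum) auto
    finally show ?thesis by (simp add: N_def)
  qed
  define code where "code \<beta> = (\<Sum>k<?n. \<beta> (h k) * N ^ k)" for \<beta> :: "'n \<Rightarrow> nat"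
  have inj: "\<beta> = \<gamma>" if "\<beta> \<in> A" "\<gamma> \<in> A" "code \<beta> = code \<gamma>" for \<beta> \<gamma>
  proof
    fix i
    obtain k where "k < ?n" "i = h k" using h by (auto simp: bij_betw_def)
    then show "\<beta> i = \<gamma> i"
      using digits_unique[of ?n "\<lambda>k. \<beta> (h k)" N "\<lambda>k. \<gamma> (h k)" k] that N by (simp add: code_def)
  qed
  have "(\<Sum>\<beta>\<in>A. monom (c \<beta>) (code \<beta>)) = 0"
  proof (rule poly_eqI_infinite[OF inf])
    fix \<theta>
    define x :: "'k^'n" where "x = (\<chi> i. \<theta> ^ (N ^ g i))"
    have "monomial \<beta> x = \<theta> ^ code \<beta>" for \<beta>
    proof -
      have "monomial \<beta> x = (\<Prod>k<?n. (x $ h k) ^ \<beta> (h k))"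
        unfolding monomial_def using prod.reindex_bij_betw[OF h, of "\<lambda>i. (x $ i) ^ \<beta> i"] by simp
      also have "\<dots> = (\<Prod>k<?n. \<theta> ^ (\<beta> (h k) * N ^ k))"
        by (intro prod.cong) (auto simp: x_def gh power_mult[symmetric] mult.commute)
      finally show ?thesis by (simp add: code_def power_sum)
    qed
    then show "poly (\<Sum>\<beta>\<in>A. monom (c \<beta>) (code \<beta>)) \<theta> = poly 0 \<theta>"
      using zero[of x] by (simp add: poly_sum poly_monom)
  qed
  then have "0 = coeff (\<Sum>\<beta>\<in>A. monom (c \<beta>) (code \<beta>)) (code \<alpha>)" by simp
  also have "\<dots> = (\<Sum>\<beta>\<in>A. if \<beta> = \<alpha> then c \<beta> else 0)"
    unfolding coeff_sum by (intro sum.cong) (use inj \<open>\<alpha> \<in> A\<close> in auto)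
  also have "\<dots> = c \<alpha>" using A \<open>\<alpha> \<in> A\<close> by simp
  finally show ?thesis by simp
qed

text \<open>Each point imposes one linear condition per Taylor coefficient of degree below
  \<open>M\<close>, so there are more unknowns than conditions. Only a nonzero coefficient vector is
  asserted; \<open>monomials_independent\<close> turns it into a nonzero function.\<close>

lemma vanishing_polynomial:
  fixes X :: "('k::field^'n) set"
  assumes inf: "infinite (UNIV :: 'k set)" and X: "finite X" and M: "M > 0"
    and card: "card X * card (exponents (M - 1) :: ('n \<Rightarrow> nat) set) < card (exponents d :: ('n \<Rightarrow> nat) set)"
  shows "\<exists>c. (\<exists>\<alpha>\<in>exponents d. c \<alpha> \<noteq> 0) \<and>
     (\<forall>x\<in>X. vanishes_to_order UNIV (\<lambda>z::'k^'n. \<Sum>\<alpha>\<in>exponents d. c \<alpha> * monomial \<alpha> z) x M)"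
proof -
  let ?E = "exponents d :: ('n \<Rightarrow> nat) set"
  have "\<exists>t. \<forall>y. monomial \<alpha> (x + y) = (\<Sum>\<beta>\<in>?E. t \<beta> * monomial \<beta> y)"
    if "\<alpha> \<in> ?E" for \<alpha> and x :: "'k^'n"
    using that by (intro polyfun_coefficients polyfun_translate polyfun_monomial) (simp add: exponents_def)
  then obtain t where t: "\<And>\<alpha> x y. \<alpha> \<in> ?E \<Longrightarrow>
      monomial \<alpha> (x + y :: 'k^'n) = (\<Sum>\<beta>\<in>?E. t \<alpha> x \<beta> * monomial \<beta> y)" by metis
  have "card (X \<times> (exponents (M - 1) :: ('n \<Rightarrow> nat) set)) < card ?E"
    using card by (simp add: card_cartesian_product)
  from homogeneous_system_nontrivial[OF _ finite_exponents this, of "\<lambda>(x,\<beta>) \<alpha>. t \<alpha> x \<beta>"] X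
  obtain c where c: "\<exists>\<alpha>\<in>?E. c \<alpha> \<noteq> 0"
    "\<And>x \<beta>. x \<in> X \<Longrightarrow> \<beta> \<in> exponents (M - 1) \<Longrightarrow> (\<Sum>\<alpha>\<in>?E. t \<alpha> x \<beta> * c \<alpha>) = 0" by fastforce
  define f where "f z = (\<Sum>\<alpha>\<in>?E. c \<alpha> * monomial \<alpha> z)" for z :: "'k^'n"
  have "vanishes_to_order UNIV f x M" if x: "x \<in> X" for x
    unfolding vanishes_to_order_def
  proof (intro ballI allI impI)
    fix y j assume j: "j < M"
    define C where "C \<beta> = (\<Sum>\<alpha>\<in>?E. t \<alpha> x \<beta> * c \<alpha>)" for \<beta>
    have "f (x + e *s y) = (\<Sum>\<beta>\<in>?E. (C \<beta> * monomial \<beta> y) * e ^ sum \<beta> UNIV)" for e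
    proof -
      have "f (x + e *s y) = (\<Sum>\<alpha>\<in>?E. \<Sum>\<beta>\<in>?E. c \<alpha> * (t \<alpha> x \<beta> * monomial \<beta> (e *s y)))"
        unfolding f_def by (intro sum.cong) (simp_all add: t sum_distrib_left)
      also have "\<dots> = (\<Sum>\<beta>\<in>?E. \<Sum>\<alpha>\<in>?E. c \<alpha> * (t \<alpha> x \<beta> * monomial \<beta> (e *s y)))"
        by (rule sum.swap)
      also have "\<dots> = (\<Sum>\<beta>\<in>?E. C \<beta> * monomial \<beta> (e *s y))"
        by (simp add: C_def sum_distrib_right sum_distrib_left mult_ac)
      also have "\<dots> = (\<Sum>\<beta>\<in>?E. (C \<beta> * monomial \<beta> y) * e ^ sum \<beta> UNIV)"
        by (simp add: monomial_def power_mult_distrib prod.distrib power_sum mult_ac)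
      finally show ?thesis .
    qed
    from hasse_eqI[OF inf finite_exponents this, of j]
    have "hasse y j f x = (\<Sum>\<beta>\<in>?E. if sum \<beta> UNIV = j then C \<beta> * monomial \<beta> y else 0)" .
    also have "\<dots> = 0"
      by (intro sum.neutral) (use j M c(2)[OF x] in \<open>auto simp: C_def exponents_def\<close>)
    finally show "hasse y j f x = 0" .
  qed
  with c(1) show ?thesis unfolding f_def by blast
qed

section \<open>The leading form\<close>

lemma coeff_mult_top:
  fixes p r :: "'k::comm_ring_1 poly"
  assumes "degree p \<le> m" "degree r \<le> n"
  shows "coeff (p * r) (m + n) = coeff p m * coeff r n"
proof -
  have "coeff p i * coeff r (m + n - i) = 0" if "i \<noteq> m" "i \<le> m + n" for i
    using that assms by (cases "i < m") (auto simp: coeff_eq_0)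
  then have "(\<Sum>i\<le>m + n. coeff p i * coeff r (m + n - i)) = (\<Sum>i\<in>{m}. coeff p i * coeff r (m + n - i))"
    by (intro sum.mono_neutral_right) auto
  then show ?thesis by (simp add: coeff_mult)
qed

text \<open>In the product of the powers of \<open>x $ i + e * w $ i\<close>, the top coefficient in
  \<open>e\<close> takes the \<open>e\<close>-part of every factor, so the base point
  \<open>x\<close> disappears.\<close>

lemma hasse_monomial_top:
  fixes x w :: "'k::field^'n"
  assumes inf: "infinite (UNIV :: 'k set)"
  shows "hasse w (sum \<alpha> UNIV) (monomial \<alpha>) x = monomial \<alpha> w"
proof -
  define p where "p I = (\<Prod>i\<in>I. [:x $ i, w $ i:] ^ \<alpha> i)" for I
  have pw: "degree ([:a, b:] ^ k) \<le> k \<and> coeff ([:a, b:] ^ k) k = b ^ k" for a b :: 'k and k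
  proof (induction k)
    case (Suc k)
    have d: "degree [:a, b:] \<le> 1" by simp
    have "degree ([:a, b:] * [:a, b:] ^ k) \<le> 1 + k"
      using degree_mult_le[of "[:a, b:]" "[:a, b:] ^ k"] Suc d by linarith
    moreover have "coeff ([:a, b:] * [:a, b:] ^ k) (1 + k) = b * b ^ k"
      using Suc d by (subst coeff_mult_top) auto
    ultimately show ?case by simp
  qed simp
  have "degree (p I) \<le> sum \<alpha> I \<and> coeff (p I) (sum \<alpha> I) = (\<Prod>i\<in>I. (w $ i) ^ \<alpha> i)" for I
  proof (induction I rule: infinite_finite_induct)
    case (insert i I)
    have e: "p (insert i I) = [:x $ i, w $ i:] ^ \<alpha> i * p I"
      "sum \<alpha> (insert i I) = \<alpha> i + sum \<alpha> I" using insert.hyps by (simp_all add: p_def)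
    have "degree ([:x $ i, w $ i:] ^ \<alpha> i * p I) \<le> \<alpha> i + sum \<alpha> I"
      using degree_mult_le[of "[:x $ i, w $ i:] ^ \<alpha> i" "p I"] insert.IH pw[of "x $ i" "w $ i" "\<alpha> i"]
      by linarith
    moreover have "coeff ([:x $ i, w $ i:] ^ \<alpha> i * p I) (\<alpha> i + sum \<alpha> I) = (\<Prod>i\<in>insert i I. (w $ i) ^ \<alpha> i)"
      using insert pw by (subst coeff_mult_top) auto
    ultimately show ?case unfolding e by blast
  qed (auto simp: p_def)
  moreover have "along (monomial \<alpha>) x w = p UNIV"
    by (rule along_unique[OF inf]) (simp add: p_def poly_prod monomial_def)
  ultimately show ?thesis by (simp add: hasse_def monomial_def)
qed

text \<open>\<open>d'\<close> is the true degree of \<open>f\<close> and \<open>H\<close> its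
  homogeneous part of that degree. The last clause is the point: the derivative of order
  \<open>d'\<close> does not depend on where it is taken, so information gathered on a plane bears
  on \<open>H\<close> at the directions of that plane.\<close>

lemma top_part:
  fixes c :: "('n::finite \<Rightarrow> nat) \<Rightarrow> 'k::field"
  assumes inf: "infinite (UNIV :: 'k set)" and "\<exists>\<alpha>\<in>exponents d. c \<alpha> \<noteq> 0"
  defines "f \<equiv> \<lambda>z::'k^'n. \<Sum>\<alpha>\<in>exponents d. c \<alpha> * monomial \<alpha> z"
  shows "\<exists>d'\<le>d. \<exists>H. polyfun d' f \<and> polyfun d' H \<and> (\<exists>z. H z \<noteq> 0) \<and> (\<forall>x w. hasse w d' f x = H w)"
proof -
  let ?A = "{\<alpha> \<in> exponents d. c \<alpha> \<noteq> 0}"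
  define d' where "d' = Max ((\<lambda>\<alpha>. sum \<alpha> UNIV) ` ?A)"
  have A: "finite ?A" "?A \<noteq> {}" using assms(2) by auto
  have le: "sum \<alpha> UNIV \<le> d'" if "\<alpha> \<in> ?A" for \<alpha>
    unfolding d'_def using that A by (intro Max_ge) auto
  obtain \<alpha>0 where \<alpha>0: "\<alpha>0 \<in> ?A" "sum \<alpha>0 UNIV = d'"
    using Max_in[of "(\<lambda>\<alpha>. sum \<alpha> UNIV) ` ?A"] A unfolding d'_def by fastforce
  let ?B = "{\<alpha> \<in> ?A. sum \<alpha> UNIV = d'}"
  define H where "H z = (\<Sum>\<alpha>\<in>?B. c \<alpha> * monomial \<alpha> z)" for z :: "'k^'n"
  have f: "f = (\<lambda>z. \<Sum>\<alpha>\<in>?A. c \<alpha> * monomial \<alpha> z)"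
    unfolding f_def by (rule ext, rule sum.mono_neutral_right) auto
  have "d' \<le> d" using \<alpha>0 by (auto simp: exponents_def)
  moreover have "polyfun d' f"
    unfolding f by (intro polyfun_sum polyfun_cmult polyfun_monomial le)
  moreover have "polyfun d' H"
    unfolding H_def[abs_def] by (intro polyfun_sum polyfun_cmult polyfun_monomial) auto
  moreover have "\<exists>z. H z \<noteq> 0"
    using monomials_independent[OF inf, of ?B c \<alpha>0] \<alpha>0 A unfolding H_def by force
  moreover have "hasse w d' f x = H w" for x w
  proof -
    have m: "polyfun d' (monomial \<alpha> :: 'k^'n \<Rightarrow> 'k)" if "\<alpha> \<in> ?A" for \<alpha>
      by (rule polyfun_monomial[OF le[OF that]])
    have "f (x + e *s w) = (\<Sum>j\<le>d'. (\<Sum>\<alpha>\<in>?A. c \<alpha> * hasse w j (monomial \<alpha>) x) * e ^ j)" for e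
    proof -
      have "f (x + e *s w) = (\<Sum>\<alpha>\<in>?A. \<Sum>j\<le>d'. c \<alpha> * (hasse w j (monomial \<alpha>) x * e ^ j))"
        unfolding f by (intro sum.cong) (simp_all add: polyfun_hasse(3)[OF inf m] sum_distrib_left)
      also have "\<dots> = (\<Sum>j\<le>d'. \<Sum>\<alpha>\<in>?A. c \<alpha> * (hasse w j (monomial \<alpha>) x * e ^ j))"
        by (rule sum.swap)
      finally show ?thesis by (simp add: sum_distrib_right mult.assoc)
    qed
    from hasse_eqI[OF inf _ this, of d']
    have "hasse w d' f x = (\<Sum>\<alpha>\<in>?A. c \<alpha> * hasse w d' (monomial \<alpha>) x)" by simp
    also have "\<dots> = (\<Sum>\<alpha>\<in>?A. if sum \<alpha> UNIV = d' then c \<alpha> * monomial \<alpha> w else 0)"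
    proof (intro sum.cong refl)
      fix \<alpha> assume \<alpha>: "\<alpha> \<in> ?A"
      show "c \<alpha> * hasse w d' (monomial \<alpha>) x = (if sum \<alpha> UNIV = d' then c \<alpha> * monomial \<alpha> w else 0)"
      proof (cases "sum \<alpha> UNIV = d'")
        case True
        then show ?thesis using hasse_monomial_top[OF inf, of w \<alpha> x] by simp
      next
        case False
        then have "sum \<alpha> UNIV < d'" using le[OF \<alpha>] by simp
        then show ?thesis
          using polyfun_hasse(2)[OF inf polyfun_monomial[OF order_refl], of \<alpha> d' w x] False by simp
      qed
    qed
    also have "\<dots> = H w" unfolding H_def by (rule sum.inter_filter[symmetric, OF A(1)])
    finally show ?thesis .
  qed
  ultimately show ?thesis by blast
qed

section \<open>A Kakeya theorem for planes\<close>

text \<open>Along distinct coordinate axes the formal grid has no repetitions, so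
  \<open>gridsum\<close> becomes a sum over a box. Coordinates outside \<open>is\<close> stay fixed,
  which lets the induction over the list go through.\<close>

lemma gridsum_axes:
  fixes x :: "'k::field^'n"
  assumes T: "finite T" and "distinct is"
  defines "S \<equiv> \<lambda>is x. {z. (\<forall>i. if i \<in> set is then z $ i - x $ i \<in> T else z $ i = x $ i)} :: ('k^'n) set"
  shows "finite (S is x) \<and> gridsum T (map (\<lambda>i. axis i 1) is) m x = (\<Sum>z\<in>S is x. m z)"
  using assms(2)
proof (induction "is" arbitrary: x)
  case Nil
  have "S [] x = {x}" by (auto simp: S_def vec_eq_iff)
  then show ?case by simp
next
  case (Cons i "is")
  define e :: "'k^'n" where "e = axis i 1"
  have IH: "finite (S is y)" "gridsum T (map (\<lambda>i. axis i 1) is) m y = (\<Sum>z\<in>S is y. m z)" for y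
    using Cons by auto
  have "S (i # is) x \<subseteq> (\<Union>t\<in>T. S is (x + t *s e))"
  proof
    fix z assume z: "z \<in> S (i # is) x"
    then have "z $ i - x $ i \<in> T" by (auto simp: S_def split: if_splits)
    moreover have "z \<in> S is (x + (z $ i - x $ i) *s e)"
      using z Cons.prems by (auto simp: S_def e_def axis_def split: if_splits)
    ultimately show "z \<in> (\<Union>t\<in>T. S is (x + t *s e))" by blast
  qed
  moreover have "S is (x + t *s e) \<subseteq> S (i # is) x" if "t \<in> T" for t
    using that Cons.prems by (auto simp: S_def e_def axis_def split: if_splits)
  ultimately have U: "S (i # is) x = (\<Union>t\<in>T. S is (x + t *s e))" by blast
  have disj: "S is (x + t *s e) \<inter> S is (x + s *s e) = {}" if "t \<noteq> s" for t s
  proof -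
    have "z $ i = x $ i + t" if "z \<in> S is (x + t *s e)" for z t
      using that Cons.prems by (auto simp: S_def e_def split: if_splits)
    from this[of _ t] this[of _ s] show ?thesis using \<open>t \<noteq> s\<close> by (metis add_left_cancel disjoint_iff)
  qed
  have "(\<Sum>z\<in>S (i # is) x. m z) = (\<Sum>t\<in>T. \<Sum>z\<in>S is (x + t *s e). m z)"
    unfolding U by (rule sum.UNION_disjoint) (use T IH disj in auto)
  then show ?case using T IH(1) by (auto simp: U IH(2) e_def)
qed

lemma span_axes: "set is = UNIV \<Longrightarrow> vec.span (set (map (\<lambda>i. axis i 1 :: 'k::field^'n) is)) = UNIV"
proof -
  assume "set is = UNIV"
  then have "set (map (\<lambda>i. axis i 1 :: 'k^'n) is) = cart_basis" by (auto simp: cart_basis_def)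
  then show ?thesis by (simp add: span_cart_basis)
qed

text \<open>Parameters are counted rather than points, and the base point is free: only the pair of
  directions matters, as for Kakeya sets.\<close>

definition rich :: "nat \<Rightarrow> ('a::{field,finite}^'n) set \<Rightarrow> (('a^'n) \<times> ('a^'n)) \<Rightarrow> bool" where
  "rich N X = (\<lambda>(b1, b2). \<exists>a. N \<le> card {(s,t). a + s *s b1 + t *s b2 \<in> X})"

text \<open>All that matters about \<open>u\<close> is that it lies outside the image of the finite field: then
  \<open>s + u t\<close> determines \<open>s\<close> and \<open>t\<close>.\<close>

locale infinite_extension =
  fixes \<phi> :: "'a::{field,finite} \<Rightarrow> 'k::field" and u :: 'k
  assumes inf: "infinite (UNIV :: 'k set)"
    and \<phi>_add: "\<phi> (a + b) = \<phi> a + \<phi> b" and \<phi>_mult: "\<phi> (a * b) = \<phi> a * \<phi> b"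
    and \<phi>_inj: "inj \<phi>" and u: "\<phi> a \<noteq> u"
begin

definition emb :: "'a^'n \<Rightarrow> 'k^'n" where "emb x = (\<chi> i. \<phi> (x $ i))"

lemma emb_add: "emb (x + y) = emb x + emb y" by (simp add: emb_def vec_eq_iff \<phi>_add)

lemma emb_scale: "emb (c *s x) = \<phi> c *s emb x" by (simp add: emb_def vec_eq_iff \<phi>_mult)

lemma emb_inj: "emb x = emb y \<longleftrightarrow> x = y"
  using \<phi>_inj by (auto simp: emb_def vec_eq_iff inj_eq)

lemma plus_u_inj:
  assumes "\<phi> s + u * \<phi> t = \<phi> s' + u * \<phi> t'"
  shows "s = s' \<and> t = t'"
proof -
  have diff: "\<phi> (a - b) = \<phi> a - \<phi> b" for a b using \<phi>_add[of "a - b" b] by simp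
  have t: "t = t'"
  proof (rule ccontr)
    assume t: "t \<noteq> t'"
    have "\<phi> (t - t') \<noteq> 0" using t \<phi>_inj by (simp add: diff inj_eq)
    moreover have "u * \<phi> (t - t') = \<phi> (s' - s)"
      using assms by (simp add: diff algebra_simps)
    moreover have "\<phi> (s' - s) = \<phi> ((s' - s) / (t - t')) * \<phi> (t - t')"
      using t by (simp add: \<phi>_mult[symmetric])
    ultimately show False using u by (metis mult_right_cancel)
  qed
  with assms have "\<phi> s = \<phi> s'" by simp
  with t \<phi>_inj show ?thesis by (simp add: inj_eq)
qed

text \<open>A derivative of \<open>f\<close> of order \<open>j < l\<close> vanishes to order
  \<open>M - j\<close> at \<open>N\<close> or more grid points of the plane. As
  \<open>d * q < (M - l) * N\<close>, Schwartz--Zippel in two directions makes it zero on the whole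
  plane over the big field, in particular along \<open>b1 + u b2\<close>.\<close>

lemma top_part_vanishes_to_order:
  fixes X :: "('a^'n) set" and b1 b2 a :: "'a^'n" and f H :: "'k^'n \<Rightarrow> 'k"
  assumes f: "polyfun d f" and H: "\<And>x w. hasse w d f x = H w"
    and vanish: "\<And>x. x \<in> X \<Longrightarrow> vanishes_to_order UNIV f (emb x) M"
    and rich: "N \<le> card {(s,t). a + s *s b1 + t *s b2 \<in> X}"
    and l: "l \<le> M" "d * CARD('a) < (M - l) * N"
  shows "vanishes_to_order UNIV H (emb b1 + u *s emb b2) l"
  unfolding vanishes_to_order_def
proof (intro ballI allI impI)
  fix y j assume j: "j < l"
  let ?q = "CARD('a)" and ?z = "emb b1 + u *s emb b2" and ?es = "[emb b1, emb b2]"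
  have zero: "hasse z i (hasse y j f) (emb a) = 0" if j: "j < l" and z: "z = ?z" for i j z
  proof -
    define Q where "Q = hasse y j f"
    have Q: "polyfun (d - j) Q" unfolding Q_def by (rule polyfun_hasse(1)[OF inf f])
    define m where "m p = (if p \<in> emb ` X then M - j else 0)" for p :: "'k^'n"
    have van: "\<forall>v\<in>vec.span (set ?es). Q (emb a + v) = 0"
    proof (rule ccontr)
      assume "\<not> (\<forall>v\<in>vec.span (set ?es). Q (emb a + v) = 0)"
      then have nz: "\<exists>v\<in>vec.span (set ?es). Q (emb a + v) \<noteq> 0" by blast
      have "vanishes_to_order (vec.span (set ?es)) Q p (m p)" for p
        unfolding vanishes_to_order_def Q_def using vanishes_to_order_hasse[OF inf f vec.subspace_UNIV vanish, of _ y]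
        by (auto simp: m_def less_diff_conv)
      then have "card (range \<phi>) * gridsum (range \<phi>) ?es m (emb a) \<le> (d - j) * card (range \<phi>) ^ length ?es"
        by (intro schwartz_zippel_multiplicity[OF inf _ Q _ nz]) auto
      moreover have "gridsum (range \<phi>) ?es m (emb a) = (M - j) * card {(s,t). a + s *s b1 + t *s b2 \<in> X}"
      proof -
        have "gridsum (range \<phi>) ?es m (emb a) = (\<Sum>s\<in>UNIV. \<Sum>t\<in>UNIV. m (emb (a + s *s b1 + t *s b2)))"
          using \<phi>_inj by (simp add: sum.reindex emb_add emb_scale)
        also have "\<dots> = (\<Sum>p\<in>UNIV. m (emb (a + fst p *s b1 + snd p *s b2)))"
          by (simp add: sum.cartesian_product case_prod_beta)
        also have "\<dots> = (\<Sum>p\<in>UNIV. if p \<in> {(s,t). a + s *s b1 + t *s b2 \<in> X} then M - j else 0)"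
          by (intro sum.cong) (auto simp: m_def emb_inj image_iff)
        finally show ?thesis by (simp add: sum.If_cases mult.commute)
      qed
      ultimately have "?q * ((M - j) * card {(s,t). a + s *s b1 + t *s b2 \<in> X}) \<le> (d - j) * ?q ^ 2"
        using \<phi>_inj by (simp add: card_image power2_eq_square)
      moreover have "(M - l) * N \<le> (M - j) * card {(s,t). a + s *s b1 + t *s b2 \<in> X}"
        using rich j by (intro mult_mono) auto
      then have "?q * ((M - l) * N) \<le> ?q * ((M - j) * card {(s,t). a + s *s b1 + t *s b2 \<in> X})"
        by (rule mult_le_mono2)
      moreover have "(d - j) * ?q ^ 2 \<le> ?q * (d * ?q)" by (simp add: power2_eq_square)
      moreover have "?q * (d * ?q) < ?q * ((M - l) * N)" using l by simp
      ultimately show False by linarith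
    qed
    \<comment> \<open>Here vanishing over the extension field enters: \<open>z\<close> has the
      coefficient \<open>u\<close>, which lies outside the finite field.\<close>
    have "along Q (emb a) z = 0"
    proof (rule along_unique[OF inf])
      fix c
      have "c *s z \<in> vec.span (set ?es)"
        unfolding z by (intro vec.span_scale vec.span_add) (auto intro: vec.span_base vec.span_scale)
      then show "poly 0 c = Q (emb a + c *s z)" using van by simp
    qed
    then show ?thesis by (simp add: hasse_def[of z] Q_def)
  qed
  show "hasse y j H ?z = 0"
  proof -
    \<comment> \<open>The left side is a derivative of \<open>f\<close> of order \<open>d\<close> at
      \<open>emb a\<close>. Its coefficient at \<open>c^j\<close> is a derivative along
      \<open>?z\<close> of \<open>hasse y j f\<close>, hence zero for \<open>j < l\<close>.\<close>
    have "H (?z + c *s y) = (\<Sum>j\<le>d. hasse ?z (d - j) (hasse y j f) (emb a) * c ^ j)" for c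
      unfolding H[symmetric, of _ "emb a"] by (rule hasse_mixed_direction[OF inf f order_refl])
    from hasse_eqI[OF inf _ this, of j]
    show ?thesis using zero[OF j refl] by simp
  qed
qed

text \<open>If \<open>X\<close> were smaller, a nonzero polynomial of degree at most
  \<open>d\<close> would vanish to order \<open>M\<close> on it. Its leading form would then vanish
  to order \<open>l\<close> at \<open>card G\<close> points of a grid of side \<open>q^2\<close>,
  more than Schwartz--Zippel permits.\<close>

lemma kakeya_parameters:
  fixes X :: "('a^'n) set" and G :: "(('a^'n) \<times> ('a^'n)) set"
  assumes rich: "\<And>b. b \<in> G \<Longrightarrow> rich N X b"
    and M: "M > 0" and l: "l \<le> M" "d * CARD('a) < (M - l) * N"
    and G: "d * CARD('a) ^ (2 * CARD('n)) < l * CARD('a)^2 * card G"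
  shows "card (exponents d :: ('n \<Rightarrow> nat) set) \<le> card X * card (exponents (M - 1) :: ('n \<Rightarrow> nat) set)"
proof (rule ccontr)
  let ?q = "CARD('a)" and ?n = "CARD('n)"
  assume "\<not> ?thesis"
  moreover have "card (emb ` X) = card X" by (rule card_image) (auto simp: inj_on_def emb_inj)
  ultimately have lt: "card (emb ` X) * card (exponents (M - 1) :: ('n \<Rightarrow> nat) set) < card (exponents d :: ('n \<Rightarrow> nat) set)"
    by simp
  obtain c where c: "\<exists>\<alpha>\<in>exponents d. c \<alpha> \<noteq> 0"
    "\<And>x. x \<in> emb ` X \<Longrightarrow> vanishes_to_order UNIV (\<lambda>z::'k^'n. \<Sum>\<alpha>\<in>exponents d. c \<alpha> * monomial \<alpha> z) x M"
    using vanishing_polynomial[OF inf _ M lt] by auto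
  define f where "f = (\<lambda>z::'k^'n. \<Sum>\<alpha>\<in>exponents d. c \<alpha> * monomial \<alpha> z)"
  obtain d' H where d': "d' \<le> d" and f: "polyfun d' f" and H: "polyfun d' H" "\<exists>z. H z \<noteq> 0"
    "\<And>x w. hasse w d' f x = H w"
    using top_part[OF inf c(1)] unfolding f_def by blast
  have van: "vanishes_to_order UNIV f (emb x) M" if "x \<in> X" for x
    using c(2)[of "emb x"] that by (simp add: f_def)
  have l': "d' * ?q < (M - l) * N"
    using l(2) d' by (meson le_less_trans mult_le_mono1)
  define Z where "Z = (\<lambda>(b1,b2). emb b1 + u *s emb b2) ` G"
  have ordZ: "vanishes_to_order UNIV H z l" if "z \<in> Z" for z
    using that top_part_vanishes_to_order[OF f H(3) van _ l(1) l'] rich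
    unfolding Z_def rich_def by fastforce
  have injZ: "inj_on (\<lambda>(b1,b2). emb b1 + u *s emb b2 :: 'k^'n) G"
    using plus_u_inj by (fastforce simp: inj_on_def vec_eq_iff emb_def)
  \<comment> \<open>All coordinates of \<open>emb b1 + u *s emb b2\<close> lie in this set.\<close>
  define T where "T = (\<lambda>(s,t). \<phi> s + u * \<phi> t) ` UNIV"
  have T: "finite T" "card T = ?q ^ 2"
  proof -
    have "inj (\<lambda>(s,t). \<phi> s + u * \<phi> t)" using plus_u_inj by (fastforce simp: inj_on_def)
    then show "card T = ?q ^ 2"
      unfolding T_def by (subst card_image) (auto simp: power2_eq_square)
  qed (simp add: T_def)
  obtain "is" :: "'n list" where "is": "set is = UNIV" "distinct is"
    using finite_distinct_list[of "UNIV :: 'n set"] by auto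
  have len: "length is = ?n" using "is" distinct_card by fastforce
  let ?es = "map (\<lambda>i. axis i 1 :: 'k^'n) is"
  define m where "m z = (if z \<in> Z then l else 0)" for z
  have "card T * gridsum T ?es m 0 \<le> d' * card T ^ length ?es"
  proof (rule schwartz_zippel_multiplicity[OF inf T(1) H(1)])
    show "vanishes_to_order (vec.span (set ?es)) H (0 + y) (m (0 + y))" for y
      using ordZ[of y] unfolding m_def vanishes_to_order_def by auto
    show "\<exists>y\<in>vec.span (set ?es). H (0 + y) \<noteq> 0" using H(2) span_axes[OF "is"(1)] by auto
  qed
  moreover have "gridsum T ?es m 0 = l * card G"
  proof -
    let ?S = "{z :: 'k^'n. \<forall>i. z $ i \<in> T}"
    have "finite ?S \<and> gridsum T ?es m 0 = (\<Sum>z\<in>?S. m z)"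
      using gridsum_axes[OF T(1) "is"(2), of 0 m] "is"(1) by simp
    moreover have "Z \<subseteq> ?S" by (auto simp: Z_def T_def emb_def image_iff) blast
    ultimately have "gridsum T ?es m 0 = (\<Sum>z\<in>Z. l)"
      unfolding m_def by (simp add: sum.If_cases Int_absorb1 inf.absorb2)
    then show ?thesis using injZ by (simp add: Z_def card_image)
  qed
  ultimately have "?q ^ 2 * (l * card G) \<le> d' * ?q ^ (2 * ?n)"
    by (simp add: T(2) len power_mult)
  also have "\<dots> \<le> d * ?q ^ (2 * ?n)" using d' by simp
  finally show False using G by (simp add: mult_ac)
qed

end

text \<open>The rational function field over the finite field, with its indeterminate as
  \<open>u\<close>.\<close>

lemma infinite_extension_fract:
  "infinite_extension (\<lambda>a::'a::{field,finite}. Fract [:a:] 1) (Fract [:0, 1:] 1)"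
proof
  have "inj (\<lambda>n. monom (1::'a) n)" by (auto simp: inj_on_def monom_eq_iff')
  then have "infinite (UNIV :: 'a poly set)" using finite_imageD[of _ UNIV] infinite_UNIV_nat
    by (metis finite_subset subset_UNIV)
  moreover have "inj (\<lambda>p::'a poly. Fract p 1)" by (auto simp: inj_on_def eq_fract)
  ultimately show "infinite (UNIV :: 'a poly fract set)"
    by (metis finite_imageD finite_subset subset_UNIV)
qed (auto simp: inj_on_def eq_fract)

text \<open>The side \<open>q\<close> is lost only by a factor \<open>1 - 3/(8n)\<close>, from two
  sources: \<open>1/(4n)\<close> for the missing part of each plane and
  \<open>4/q \<le> 1/(8n)\<close> for the share of \<open>l\<close> in \<open>M\<close>. By
  Bernoulli its \<open>n\<close>-th power is at least \<open>5/8\<close>, which exceeds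
  \<open>2/5\<close>.\<close>

theorem kakeya_planes:
  fixes X :: "('a::{field,finite}^'n) set" and G :: "(('a^'n) \<times> ('a^'n)) set"
  assumes q: "32 * CARD('n) \<le> CARD('a)"
    and G: "CARD('a) ^ (2 * CARD('n)) \<le> 4 * card G"
    and N: "(4 * CARD('n) - 1) * CARD('a)^2 \<le> 4 * CARD('n) * N"
    and rich: "\<And>b. b \<in> G \<Longrightarrow> rich N X b"
  shows "2 * CARD('a) ^ CARD('n) < 5 * card X"
proof (rule ccontr)
  assume small: "\<not> ?thesis"
  let ?q = "CARD('a)" and ?n = "CARD('n)"
  interpret infinite_extension "\<lambda>a::'a. Fract [:a:] 1" "Fract [:0, 1:] 1"
    by (rule infinite_extension_fract)
  have n: "?n \<ge> 1" and q0: "?q > 0" by (simp_all add: Suc_le_eq)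
  define D where "D = (4 * ?n - 1) * ?n * ?q^2"
  \<comment> \<open>chosen so that \<open>D / (M + n - 1)\<close>, which bounds the \<open>n\<close>-th root of \<open>|X|\<close> from below, is at least
    \<open>(1 - 3/(8n)) q\<close>\<close>
  define d l M where "d = D - 1" and "l = 4 * (4 * ?n - 1) * ?n" and "M = l + 4 * ?n^2 * ?q"
  have "4 * ?n - 1 > 0" using n by linarith
  then have D: "D > 0" using n q0 unfolding D_def by (intro mult_pos_pos zero_less_power) linarith+
  have "card (exponents d :: ('n \<Rightarrow> nat) set) \<le> card X * card (exponents (M - 1) :: ('n \<Rightarrow> nat) set)"
  proof (rule kakeya_parameters)
    show "rich N X b" if "b \<in> G" for b by (rule rich[OF that])
    show "M > 0" using n q0 by (simp add: M_def)
    \<comment> \<open>Passing from \<open>D\<close> to \<open>d = D - 1\<close> makes both parameter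
      inequalities strict; the lost unit returns in \<open>binomial_lower_power\<close>, where
      \<open>d + 1 = D\<close>.\<close>
    have "D * ?q = ?n * ?q * ((4 * ?n - 1) * ?q^2)" by (simp add: D_def)
    also have "\<dots> \<le> ?n * ?q * (4 * ?n * N)" by (rule mult_le_mono2[OF N])
    also have "\<dots> = (M - l) * N" by (simp add: M_def power2_eq_square)
    finally have "D * ?q \<le> (M - l) * N" .
    moreover have "d * ?q < D * ?q" using D q0 by (simp add: d_def)
    ultimately show "d * ?q < (M - l) * N" by linarith
    \<comment> \<open>\<open>l\<close> is chosen so that \<open>l * q^2 = 4 * D\<close>; the
      \<open>4\<close> compensates for the density \<open>1/4\<close> of \<open>G\<close>.\<close>
    have "D * ?q ^ (2 * ?n) \<le> D * (4 * card G)" by (rule mult_le_mono2[OF G])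
    also have "\<dots> = l * ?q^2 * card G" by (simp add: D_def l_def)
    finally have "D * ?q ^ (2 * ?n) \<le> l * ?q^2 * card G" .
    moreover have "d * ?q ^ (2 * ?n) < D * ?q ^ (2 * ?n)" using D q0 by (simp add: d_def)
    ultimately show "d * ?q ^ (2 * ?n) < l * ?q^2 * card G" by linarith
  qed (simp add: M_def)
  \<comment> \<open>Multiplied by \<open>n!\<close>, the binomials compare with \<open>n\<close>-th
    powers: \<open>D ^ n\<close> from below and \<open>(M - 1 + n) ^ n\<close> from above.\<close>
  then have "(d + ?n choose ?n) * fact ?n \<le> card X * ((M - 1 + ?n choose ?n) * fact ?n)"
    unfolding card_exponents by (metis mult.assoc mult_le_mono1)
  also have "\<dots> \<le> card X * (M - 1 + ?n) ^ ?n"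
    by (intro mult_le_mono2) (rule binomial_fact_pow)
  also have "\<dots> \<le> card X * (4 * ?n^2 * (?q + 4)) ^ ?n"
  proof -
    have nn: "?n \<le> ?n * (?n * 16)" using n by simp
    have "M - 1 + ?n \<le> 4 * ?n^2 * (?q + 4)"
      using n by (simp add: M_def l_def power2_eq_square algebra_simps diff_mult_distrib) (use nn n in linarith)
    then show ?thesis by (intro mult_le_mono2 power_mono) auto
  qed
  finally have 1: "(d + ?n choose ?n) * fact ?n \<le> card X * (4 * ?n^2 * (?q + 4)) ^ ?n" .
  have "D ^ ?n \<le> (d + ?n choose ?n) * fact ?n"
    using binomial_lower_power[of d ?n] D by (simp add: d_def)
  with 1 have "D ^ ?n \<le> card X * (4 * ?n^2 * (?q + 4)) ^ ?n" by linarith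
  then have "5 * D ^ ?n \<le> (5 * card X) * (4 * ?n^2 * (?q + 4)) ^ ?n" by simp
  also have "\<dots> \<le> (2 * ?q ^ ?n) * (4 * ?n^2 * (?q + 4)) ^ ?n"
    by (rule mult_le_mono1) (use small in simp)
  finally have "5 * real D ^ ?n \<le> 2 * real ?q ^ ?n * (4 * real ?n^2 * (real ?q + 4)) ^ ?n"
    by (simp add: of_nat_le_iff[symmetric, where 'a = real] del: of_nat_le_iff)
  also have "\<dots> = 2 * (real ?q * (4 * real ?n^2 * (real ?q + 4))) ^ ?n"
    by (simp add: power_mult_distrib)
  finally have 2: "5 * real D ^ ?n \<le> 2 * (real ?q * (4 * real ?n^2 * (real ?q + 4))) ^ ?n" .
  have "5 / 8 * (real ?q * (4 * real ?n^2 * (real ?q + 4))) ^ ?n \<le> real D ^ ?n"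
  proof -
    define x where "x = 3 / (8 * real ?n)"
    have n': "1 \<le> real ?n" using n by linarith
    then have x: "0 \<le> x" "x \<le> 1" unfolding x_def by (simp, subst divide_le_eq_1, linarith)
    have "5 / 8 = 1 + real ?n * (- x)" using n by (simp add: x_def)
    also have "\<dots> \<le> (1 + - x) ^ ?n" using x by (intro Bernoulli_inequality) auto
    finally have "5 / 8 \<le> (1 - x) ^ ?n" by simp
    then have "5 / 8 * (real ?q * (4 * real ?n^2 * (real ?q + 4))) ^ ?n
             \<le> ((1 - x) * (real ?q * (4 * real ?n^2 * (real ?q + 4)))) ^ ?n"
      unfolding power_mult_distrib by (intro mult_right_mono) auto
    also have "\<dots> \<le> real D ^ ?n"
    proof (rule power_mono)
      \<comment> \<open>Expanded, this says \<open>16 n - 6 \<le> q / 2\<close>, which is where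
        \<open>32 n \<le> q\<close> enters.\<close>
      have "(1 - x) * (4 * real ?n) * (real ?q + 4) \<le> (4 * real ?n - 1) * real ?q"
      proof -
        have "(1 - x) * (4 * real ?n) = 4 * real ?n - 3 / 2" using n by (simp add: x_def field_simps)
        moreover have "32 * real ?n \<le> real ?q" using q by linarith
        ultimately have "(4 * real ?n - 3 / 2) * (real ?q + 4) \<le> (4 * real ?n - 1) * real ?q"
          by (simp add: algebra_simps)
        then show ?thesis using \<open>(1 - x) * (4 * real ?n) = 4 * real ?n - 3 / 2\<close> by (simp only:)
      qed
      then have "((1 - x) * (4 * real ?n) * (real ?q + 4)) * (real ?n * real ?q)
               \<le> ((4 * real ?n - 1) * real ?q) * (real ?n * real ?q)"
        by (intro mult_right_mono) auto
      moreover have "real D = ((4 * real ?n - 1) * real ?q) * (real ?n * real ?q)"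
        using n by (simp add: D_def power2_eq_square of_nat_diff)
      ultimately show "(1 - x) * (real ?q * (4 * real ?n^2 * (real ?q + 4))) \<le> real D"
        by (simp add: power2_eq_square mult_ac)
    qed (use x in auto)
    finally show ?thesis .
  qed
  moreover have "0 < (real ?q * (4 * real ?n^2 * (real ?q + 4))) ^ ?n"
    using n q0 by (intro zero_less_power mult_pos_pos) auto
  ultimately show False using 2 by linarith
qed

section \<open>Linear automorphisms and frames\<close>

abbreviation vlinear :: "('a::field^'n \<Rightarrow> 'a^'n) \<Rightarrow> bool" where
  "vlinear \<equiv> Vector_Spaces.linear (*s) (*s)"

lemma independent_bijection_extends:
  fixes B B' :: "('a::{field,finite}^'n) set"
  assumes B: "vec.independent B" and B': "vec.independent B'" and \<phi>: "bij_betw \<phi> B B'"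
  shows "\<exists>f. vlinear f \<and> bij f \<and> (\<forall>b\<in>B. f b = \<phi> b)"
proof -
  obtain D where D: "B \<subseteq> D" "vec.independent D" "vec.span D = UNIV"
    using vec.maximal_independent_subset_extend[OF subset_UNIV B] by (metis top.extremum_uniqueI)
  obtain D' where D': "B' \<subseteq> D'" "vec.independent D'" "vec.span D' = UNIV"
    using vec.maximal_independent_subset_extend[OF subset_UNIV B'] by (metis top.extremum_uniqueI)
  have "card D = card D'"
    using vec.dim_eq_card_independent[OF D(2)] vec.dim_eq_card_independent[OF D'(2)] D(3) D'(3)
    by (metis vec.dim_span)
  moreover have "card B = card B'" using \<phi> by (rule bij_betw_same_card)
  ultimately have "card (D - B) = card (D' - B')"
    using D(1) D'(1) by (simp add: card_Diff_subset)
  then obtain \<psi> where \<psi>: "bij_betw \<psi> (D - B) (D' - B')"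
    using finite_same_card_bij[of "D - B" "D' - B'"] by auto
  define \<theta> where "\<theta> x = (if x \<in> B then \<phi> x else \<psi> x)" for x
  obtain f where f: "vlinear f" "\<And>x. x \<in> D \<Longrightarrow> f x = \<theta> x"
    using vec.linear_independent_extend[OF D(2), of \<theta>] by auto
  have "\<theta> ` D = \<phi> ` B \<union> \<psi> ` (D - B)" using D(1) by (auto simp: \<theta>_def)
  then have "f ` D = D'"
    using f(2) \<phi> \<psi> D'(1) by (auto simp: bij_betw_def)
  then have "range f = UNIV"
    using vec.linear_span_image[OF f(1), of D] D(3) D'(3) by simp
  then have "bij f" by (simp add: bij_def finite_UNIV_surj_inj)
  moreover have "\<forall>b\<in>B. f b = \<phi> b" using f(2) D(1) by (auto simp: \<theta>_def)
  ultimately show ?thesis using f(1) by blast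
qed

lemma vlinear_bij_image_linsubs:
  fixes A :: "('a::{field,finite}^'n) set"
  assumes f: "vlinear f" "bij f"
  shows "f ` A \<in> linsubs k \<longleftrightarrow> A \<in> linsubs k"
proof -
  have *: "f ` A \<in> linsubs k" if f: "vlinear f" "bij f" and "A \<in> linsubs k" for f and A :: "('a^'n) set"
  proof -
    have "vec.dim (f ` A) = vec.dim A"
      using f by (intro vec.dim_image_eq) (auto simp: bij_def inj_on_def)
    then show ?thesis using that by (auto simp: linsubs_def intro: vec.linear_subspace_image)
  qed
  obtain g where g: "vlinear g" "g \<circ> f = id"
    using vec.linear_injective_left_inverse[OF f(1)] f(2) by (auto simp: bij_def)
  have "g = inv f" using g(2) f(2) by (metis bij_betw_def inv_unique_comp surj_iff comp_assoc comp_id id_comp)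
  then have "bij g" using f(2) bij_imp_bij_inv by blast
  have "g ` (f ` A) = A" using g(2) by (metis image_comp image_id id_apply)
  then show ?thesis using *[OF f] *[OF g(1) \<open>bij g\<close>, of "f ` A"] by auto
qed

text \<open>Such counts depend on \<open>W\<close> and \<open>v\<close> only up to automorphism;
  with transitivity they become constants.\<close>

lemma card_linsubs_within:
  fixes W W' :: "('a::{field,finite}^'n) set"
  assumes f: "vlinear f" "bij f"
  shows "card {C \<in> linsubs c. C \<subseteq> f ` W \<and> f v \<in> C} = card {C \<in> linsubs c. C \<subseteq> W \<and> v \<in> C}"
    "card {C \<in> linsubs c. C \<subseteq> f ` W} = card {C \<in> linsubs c. C \<subseteq> W}"
proof -
  have "bij ((`) f)" using bij_betw_image_Pow[OF f(2)] by simp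
  have *: "card {C \<in> linsubs c. P C} = card {C \<in> linsubs c. Q C}" if "\<And>C. P (f ` C) \<longleftrightarrow> Q C" for P Q
  proof -
    have "{C \<in> linsubs c. P C} = (`) f ` {C \<in> linsubs c. Q C}"
    proof safe
      fix C assume C: "C \<in> linsubs c" "P C"
      obtain C' where "C = f ` C'" using \<open>bij ((`) f)\<close> by (metis bij_pointE)
      then show "C \<in> (`) f ` {C \<in> linsubs c. Q C}"
        using C that vlinear_bij_image_linsubs[OF f] by blast
    qed (use that vlinear_bij_image_linsubs[OF f] in auto)
    then show ?thesis using \<open>bij ((`) f)\<close> by (simp add: card_image bij_def inj_on_subset[of _ UNIV])
  qed
  have inj: "inj f" using f(2) by (simp add: bij_def)
  show "card {C \<in> linsubs c. C \<subseteq> f ` W \<and> f v \<in> C} = card {C \<in> linsubs c. C \<subseteq> W \<and> v \<in> C}"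
    by (rule *) (simp add: inj_image_subset_iff[OF inj] inj_image_mem_iff[OF inj])
  show "card {C \<in> linsubs c. C \<subseteq> f ` W} = card {C \<in> linsubs c. C \<subseteq> W}"
    by (rule *) (simp add: inj_image_subset_iff[OF inj])
qed

lemma linsubs_transitive:
  fixes A A' :: "('a::{field,finite}^'n) set"
  assumes "A \<in> linsubs k" "A' \<in> linsubs k"
  shows "\<exists>f. vlinear f \<and> bij f \<and> f ` A = A'"
    and "v \<in> A \<Longrightarrow> v \<noteq> 0 \<Longrightarrow> v' \<in> A' \<Longrightarrow> v' \<noteq> 0 \<Longrightarrow> \<exists>f. vlinear f \<and> bij f \<and> f ` A = A' \<and> f v = v'"
proof -
  have sub: "vec.subspace A" "vec.subspace A'" and dim: "vec.dim A = k" "vec.dim A' = k"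
    using assms by (auto simp: linsubs_def)
  \<comment> \<open>Prescribing the map on an arbitrary independent set covers both claims: the
    empty set for a subspace alone, a singleton for a subspace with a marked nonzero vector.\<close>
  have main: "\<exists>f. vlinear f \<and> bij f \<and> f ` A = A' \<and> (\<forall>b\<in>E. f b = g b)"
    if E: "vec.independent E" "E \<subseteq> A" and E': "vec.independent E'" "E' \<subseteq> A'" and g: "bij_betw g E E'"
    for E E' and g :: "'a^'n \<Rightarrow> 'a^'n"
  proof -
    obtain B where B: "E \<subseteq> B" "B \<subseteq> A" "vec.independent B" "A \<subseteq> vec.span B"
      using vec.maximal_independent_subset_extend[OF E(2,1)] by auto
    obtain B' where B': "E' \<subseteq> B'" "B' \<subseteq> A'" "vec.independent B'" "A' \<subseteq> vec.span B'"
      using vec.maximal_independent_subset_extend[OF E'(2,1)] by auto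
    have spB: "vec.span B = A" using B sub vec.span_minimal by blast
    have spB': "vec.span B' = A'" using B' sub vec.span_minimal by blast
    have "card B = card B'"
      using vec.dim_eq_card_independent[OF B(3)] vec.dim_eq_card_independent[OF B'(3)] dim spB spB'
      by (metis vec.dim_span)
    moreover have "card E = card E'" using g by (rule bij_betw_same_card)
    ultimately have "card (B - E) = card (B' - E')"
      using B(1) B'(1) by (simp add: card_Diff_subset)
    then obtain \<psi> where \<psi>: "bij_betw \<psi> (B - E) (B' - E')"
      using finite_same_card_bij[of "B - E" "B' - E'"] by auto
    define \<theta> where "\<theta> x = (if x \<in> E then g x else \<psi> x)" for x
    have "bij_betw \<theta> E E'" using g by (subst bij_betw_cong[of _ _ g]) (auto simp: \<theta>_def)
    moreover have "bij_betw \<theta> (B - E) (B' - E')" using \<psi> by (subst bij_betw_cong[of _ _ \<psi>]) (auto simp: \<theta>_def)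
    ultimately have "bij_betw \<theta> (E \<union> (B - E)) (E' \<union> (B' - E'))" by (intro bij_betw_combine) auto
    moreover have "E \<union> (B - E) = B" "E' \<union> (B' - E') = B'" using B(1) B'(1) by auto
    ultimately have \<theta>: "bij_betw \<theta> B B'" by simp
    obtain f where f: "vlinear f" "bij f" "\<And>b. b \<in> B \<Longrightarrow> f b = \<theta> b"
      using independent_bijection_extends[OF B(3) B'(3) \<theta>] by blast
    have "f ` B = B'" using \<theta> f(3) by (auto simp: bij_betw_def)
    then have "f ` A = A'" using vec.linear_span_image[OF f(1), of B] spB spB' by simp
    moreover have "f b = g b" if "b \<in> E" for b using f(3)[of b] B(1) that by (auto simp: \<theta>_def)
    ultimately show ?thesis using f(1,2) by blast
  qed
  show "\<exists>f. vlinear f \<and> bij f \<and> f ` A = A'"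
    using main[of "{}" "{}" id] vec.independent_empty by auto
  show "\<exists>f. vlinear f \<and> bij f \<and> f ` A = A' \<and> f v = v'" if "v \<in> A" "v \<noteq> 0" "v' \<in> A'" "v' \<noteq> 0"
    using main[of "{v}" "{v'}" "\<lambda>_. v'"] that by (auto simp: vec.dependent_single bij_betw_def)
qed

section \<open>Cardinalities of subspaces and frames\<close>

lemma card_span_insert:
  fixes B :: "('a::{field,finite}^'n) set"
  assumes "b \<notin> vec.span B"
  shows "card (vec.span (insert b B)) = CARD('a) * card (vec.span B)"
proof -
  let ?h = "\<lambda>(k, x). x + k *s b"
  have "inj_on ?h (UNIV \<times> vec.span B)"
  proof (rule inj_onI, clarify)
    fix k k' x x' assume x: "x \<in> vec.span B" "x' \<in> vec.span B" and eq: "x + k *s b = x' + k' *s b"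
    have "k = k'"
    proof (rule ccontr)
      assume k: "k \<noteq> k'"
      have "(k - k') *s b = x' - x" using eq by (simp add: vec.scale_left_diff_distrib algebra_simps)
      then have "(k - k') *s b \<in> vec.span B" using x by (simp add: vec.span_diff)
      then have "inverse (k - k') *s ((k - k') *s b) \<in> vec.span B" by (rule vec.span_scale)
      moreover have "inverse (k - k') *s ((k - k') *s b) = b"
        using k by (subst vector_smult_assoc) simp
      ultimately show False using assms by simp
    qed
    then show "k = k' \<and> x = x'" using eq by simp
  qed
  moreover have "?h ` (UNIV \<times> vec.span B) = vec.span (insert b B)"
  proof
    show "?h ` (UNIV \<times> vec.span B) \<subseteq> vec.span (insert b B)"
    proof clarify
      fix k x assume "x \<in> vec.span B"
      then have "x + k *s b - k *s b \<in> vec.span B" by simp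
      then show "x + k *s b \<in> vec.span (insert b B)" unfolding vec.span_breakdown_eq by blast
    qed
    show "vec.span (insert b B) \<subseteq> ?h ` (UNIV \<times> vec.span B)"
    proof
      fix y assume "y \<in> vec.span (insert b B)"
      then obtain k where "y - k *s b \<in> vec.span B" by (auto simp: vec.span_breakdown_eq)
      then show "y \<in> ?h ` (UNIV \<times> vec.span B)" by (intro image_eqI[of _ _ "(k, y - k *s b)"]) auto
    qed
  qed
  ultimately show ?thesis
    by (metis card_image card_cartesian_product)
qed

lemma card_span_independent:
  fixes B :: "('a::{field,finite}^'n) set"
  shows "vec.independent B \<Longrightarrow> card (vec.span B) = CARD('a) ^ card B"
proof -
  have "finite B" by simp
  then show "vec.independent B \<Longrightarrow> card (vec.span B) = CARD('a) ^ card B"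
  proof (induction B rule: finite_induct)
    case (insert b B)
    then have "b \<notin> vec.span B" "vec.independent B"
      by (auto simp: vec.independent_insert)
    then show ?case using insert by (simp add: card_span_insert)
  qed (simp add: vec.span_empty)
qed

lemma card_subspace:
  fixes A :: "('a::{field,finite}^'n) set"
  assumes "A \<in> linsubs k"
  shows "card A = CARD('a) ^ k"
proof -
  obtain B where B: "B \<subseteq> A" "vec.independent B" "A \<subseteq> vec.span B" "card B = vec.dim A"
    using vec.basis_exists[of A] by auto
  then have "vec.span B = A" using assms vec.span_minimal[OF B(1)] by (auto simp: linsubs_def)
  then show ?thesis using card_span_independent[OF B(2)] B(4) assms by (simp add: linsubs_def)
qed

lemma span_subspace [simp]: "A \<in> linsubs k \<Longrightarrow> vec.span A = A"
  by (simp add: linsubs_def vec.span_eq_iff)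

lemma linsubs_insert:
  fixes C :: "('a::{field,finite}^'n) set"
  assumes "C \<in> linsubs c" "b \<notin> C"
  shows "vec.span (insert b C) \<in> linsubs (Suc c)"
  using assms span_subspace[OF assms(1)] by (simp add: linsubs_def vec.dim_insert)

text \<open>Ordered pairs independent modulo \<open>C\<close>; for \<open>C = {0}\<close> these are
  the independent pairs. Together with \<open>C\<close> a frame spans a space of dimension two more,
  so choosing \<open>C\<close> and then a frame amounts to choosing a flag
  \<open>C \<subseteq> A\<close> uniformly.\<close>

definition frames :: "('a::{field,finite}^'n) set \<Rightarrow> (('a^'n) \<times> ('a^'n)) set" where
  "frames C = {(b1, b2). b1 \<notin> C \<and> b2 \<notin> vec.span (insert b1 C)}"

lemma card_frames_within:
  fixes A C :: "('a::{field,finite}^'n) set"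
  assumes C: "C \<in> linsubs c" "C \<subseteq> A" and A: "A \<in> linsubs k"
  shows "card (frames C \<inter> A \<times> A) = (CARD('a) ^ k - CARD('a) ^ c) * (CARD('a) ^ k - CARD('a) ^ Suc c)"
proof -
  have "frames C \<inter> A \<times> A = Sigma (A - C) (\<lambda>b1. A - vec.span (insert b1 C))"
    by (auto simp: frames_def)
  moreover have "card (A - vec.span (insert b1 C)) = CARD('a) ^ k - CARD('a) ^ Suc c" if "b1 \<in> A - C" for b1
  proof -
    have "vec.span (insert b1 C) \<subseteq> A" using that C A by (intro vec.span_minimal) (auto simp: linsubs_def)
    then show ?thesis
      using card_subspace[OF A] card_subspace[OF linsubs_insert[OF C(1), of b1]] that
      by (simp add: card_Diff_subset)
  qed
  moreover have "card (A - C) = CARD('a) ^ k - CARD('a) ^ c"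
    using C card_subspace[OF A] card_subspace[OF C(1)] by (simp add: card_Diff_subset)
  ultimately show ?thesis by (simp add: card_SigmaI)
qed

lemma UNIV_linsubs: "(UNIV :: ('a::{field,finite}^'n) set) \<in> linsubs CARD('n)"
  by (simp add: linsubs_def card_cart_basis)

lemma card_frames:
  fixes C :: "('a::{field,finite}^'n) set"
  assumes C: "C \<in> linsubs c"
  shows "card (frames C) = (CARD('a) ^ CARD('n) - CARD('a) ^ c) * (CARD('a) ^ CARD('n) - CARD('a) ^ Suc c)"
  using card_frames_within[OF C subset_UNIV UNIV_linsubs] by simp

lemma frames_span_eq_iff:
  fixes A C :: "('a::{field,finite}^'n) set"
  assumes C: "C \<in> linsubs c" and A: "A \<in> linsubs (Suc (Suc c))" and b: "(b1, b2) \<in> frames C"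
  shows "vec.span (insert b2 (insert b1 C)) = A \<longleftrightarrow> C \<subseteq> A \<and> b1 \<in> A \<and> b2 \<in> A"
proof
  assume "vec.span (insert b2 (insert b1 C)) = A"
  then show "C \<subseteq> A \<and> b1 \<in> A \<and> b2 \<in> A" by (auto intro: vec.span_base)
next
  assume *: "C \<subseteq> A \<and> b1 \<in> A \<and> b2 \<in> A"
  have "vec.span (insert b2 (insert b1 C)) \<in> linsubs (Suc (Suc c))"
    using b C by (auto simp: frames_def linsubs_def vec.dim_insert vec.span_eq_iff)
  moreover have "vec.span (insert b2 (insert b1 C)) \<subseteq> A"
    using * A by (intro vec.span_minimal) (auto simp: linsubs_def)
  ultimately show "vec.span (insert b2 (insert b1 C)) = A"
    using A by (intro card_subset_eq) (simp_all add: card_subspace)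
qed

lemma frame_span_linsubs:
  fixes C :: "('a::{field,finite}^'n) set"
  assumes C: "C \<in> linsubs c" and b: "(b1, b2) \<in> frames C"
  shows "vec.span (insert b2 (insert b1 C)) \<in> linsubs (Suc (Suc c))"
  using b C by (auto simp: frames_def linsubs_def vec.dim_insert vec.span_eq_iff)

lemma zero_linsubs: "{0} \<in> linsubs 0"
  by (simp add: linsubs_def vec.subspace_single_0)

text \<open>Averaging over the general linear group, which acts transitively on independent pairs.\<close>

lemma frames_average:
  fixes U G :: "(('a::{field,finite}^'n) \<times> ('a^'n)) set"
  assumes U: "U \<subseteq> frames {0}" and G: "G \<subseteq> frames {0}"
  shows "\<exists>f. vlinear f \<and> bij f \<and> card U * card G \<le> card (frames {0} :: (('a^'n) \<times> ('a^'n)) set) * card {u \<in> U. map_prod f f u \<in> G}"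
proof -
  let ?I = "frames {0} :: (('a^'n) \<times> ('a^'n)) set"
  define \<Gamma> where "\<Gamma> = {f :: 'a^'n \<Rightarrow> 'a^'n. vlinear f \<and> bij f}"
  have fin: "finite \<Gamma>" by simp
  have id: "id \<in> \<Gamma>" by (simp add: \<Gamma>_def vec.linear_id)
  have comp: "f \<circ> g \<in> \<Gamma>" if "f \<in> \<Gamma>" "g \<in> \<Gamma>" for f g
    using that by (auto simp: \<Gamma>_def bij_comp intro: Vector_Spaces.linear_compose)
  have inI: "map_prod f f u \<in> ?I \<longleftrightarrow> u \<in> ?I" if "f \<in> \<Gamma>" for f u
  proof -
    have lf: "vlinear f" and bf: "bij f" using that by (auto simp: \<Gamma>_def)
    have inj: "inj f" using bf by (simp add: bij_def)
    have "f 0 = 0" using lf by (rule vec.linear_0)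
    have sp: "vec.span {f b, 0} = f ` vec.span {b, 0}" for b
      using vec.linear_span_image[OF lf, of "{b, 0}"] \<open>f 0 = 0\<close> by simp
    show ?thesis
      by (cases u) (auto simp: frames_def sp inj_image_mem_iff[OF inj], (metis \<open>f 0 = 0\<close> inj injD)+)
  qed
  have trans: "\<exists>h\<in>\<Gamma>. map_prod h h u = u'" if "u \<in> ?I" "u' \<in> ?I" for u u'
  proof -
    obtain b1 b2 b1' b2' where u: "u = (b1, b2)" "u' = (b1', b2')" by (cases u, cases u')
    have ind: "b1 \<noteq> b2 \<and> vec.independent {b2, b1}" if "(b1, b2) \<in> ?I" for b1 b2
    proof -
      have 1: "b1 \<noteq> 0" "b2 \<notin> vec.span {b1}" using that vec.span_insert_0[of "{b1}"]
        by (auto simp: frames_def insert_commute)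
      then have "b1 \<noteq> b2" using vec.span_base[of b1 "{b1}"] by auto
      with 1 show ?thesis by (simp add: vec.independent_insert)
    qed
    have i: "b1 \<noteq> b2" "vec.independent {b2, b1}" "b1' \<noteq> b2'" "vec.independent {b2', b1'}"
      using ind that u by auto
    have "bij_betw (\<lambda>x. if x = b1 then b1' else b2') {b2, b1} {b2', b1'}"
      using i by (auto simp: bij_betw_def inj_on_def)
    from independent_bijection_extends[OF i(2,4) this] i(1)
    show ?thesis by (auto simp: \<Gamma>_def u)
  qed
  \<comment> \<open>\<open>K\<close> is constant on \<open>?I\<close>: transitivity gives
    \<open>\<le>\<close> for any two frames, hence equality. Its mean is known because every
    automorphism permutes \<open>?I\<close> and so sends exactly \<open>card G\<close> frames into
    \<open>G\<close>.\<close>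
  define K where "K u = card {f \<in> \<Gamma>. map_prod f f u \<in> G}" for u
  have K_le: "K u' \<le> K u" if "u \<in> ?I" "u' \<in> ?I" for u u'
  proof -
    obtain h where h: "h \<in> \<Gamma>" "map_prod h h u = u'" using trans[OF \<open>u \<in> ?I\<close> \<open>u' \<in> ?I\<close>] by blast
    have "inj_on (\<lambda>f. f \<circ> h) {f \<in> \<Gamma>. map_prod f f u' \<in> G}"
    proof (rule inj_onI, rule ext)
      fix f g x assume eq: "f \<circ> h = g \<circ> h"
      have "bij h" using h(1) by (simp add: \<Gamma>_def)
      then obtain y where "x = h y" by (metis bij_pointE)
      then show "f x = g x" using fun_cong[OF eq, of y] by simp
    qed
    moreover have "(\<lambda>f. f \<circ> h) ` {f \<in> \<Gamma>. map_prod f f u' \<in> G} \<subseteq> {f \<in> \<Gamma>. map_prod f f u \<in> G}"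
      using comp h by (cases u) auto
    ultimately show ?thesis unfolding K_def by (intro card_inj_on_le) auto
  qed
  have double: "(\<Sum>u\<in>V. K u) = (\<Sum>f\<in>\<Gamma>. card {u \<in> V. map_prod f f u \<in> G})" for V
  proof -
    have "(\<Sum>u\<in>V. K u) = (\<Sum>u\<in>V. \<Sum>f\<in>\<Gamma>. if map_prod f f u \<in> G then 1 else 0)"
      unfolding K_def by (simp add: sum.If_cases Int_def)
    also have "\<dots> = (\<Sum>f\<in>\<Gamma>. \<Sum>u\<in>V. if map_prod f f u \<in> G then 1 else 0)" by (rule sum.swap)
    also have "\<dots> = (\<Sum>f\<in>\<Gamma>. card {u \<in> V. map_prod f f u \<in> G})"
      by (simp add: sum.If_cases Int_def)
    finally show ?thesis .
  qed
  have "card {u \<in> ?I. map_prod f f u \<in> G} = card G" if f: "f \<in> \<Gamma>" for f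
  proof -
    have bij: "bij f" using f by (simp add: \<Gamma>_def)
    have "map_prod f f ` {u \<in> ?I. map_prod f f u \<in> G} = G"
    proof safe
      fix a b assume ab: "(a, b) \<in> G"
      obtain a' b' where "a = f a'" "b = f b'" using bij by (metis bij_pointE)
      then have m: "map_prod f f (a', b') = (a, b)" by simp
      moreover have "(a', b') \<in> ?I" using subsetD[OF G ab] unfolding m[symmetric] inI[OF f] .
      ultimately show "(a, b) \<in> map_prod f f ` {u \<in> ?I. map_prod f f u \<in> G}" using ab by force
    qed auto
    moreover have "inj (map_prod f f)" using bij by (simp add: bij_def prod.inj_map)
    then have "inj_on (map_prod f f) {u \<in> ?I. map_prod f f u \<in> G}" by (rule inj_on_subset) simp
    note card_image[OF this]
    ultimately show ?thesis by simp
  qed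
  then have sumI: "(\<Sum>u\<in>?I. K u) = card \<Gamma> * card G" by (simp add: double)
  have "card \<Gamma> * (card U * card G) = card U * (\<Sum>u\<in>?I. K u)" by (simp add: sumI)
  also have "\<dots> = (\<Sum>u\<in>U. \<Sum>u'\<in>?I. K u')" by simp
  also have "\<dots> \<le> (\<Sum>u\<in>U. \<Sum>u'\<in>?I. K u)" using U by (intro sum_mono K_le) auto
  also have "\<dots> = card ?I * (\<Sum>f\<in>\<Gamma>. card {u \<in> U. map_prod f f u \<in> G})"
    by (simp add: sum_distrib_left[symmetric] double)
  also have "\<dots> = (\<Sum>f\<in>\<Gamma>. card ?I * card {u \<in> U. map_prod f f u \<in> G})" by (simp add: sum_distrib_left)
  finally have le: "(\<Sum>f\<in>\<Gamma>. card U * card G) \<le> (\<Sum>f\<in>\<Gamma>. card ?I * card {u \<in> U. map_prod f f u \<in> G})"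
    by simp
  have "\<exists>f\<in>\<Gamma>. card U * card G \<le> card ?I * card {u \<in> U. map_prod f f u \<in> G}"
  proof (rule ccontr)
    assume "\<not> ?thesis"
    then have "(\<Sum>f\<in>\<Gamma>. card ?I * card {u \<in> U. map_prod f f u \<in> G}) < (\<Sum>f\<in>\<Gamma>. card U * card G)"
      using fin id by (intro sum_strict_mono) auto
    with le show False by simp
  qed
  then show ?thesis by (auto simp: \<Gamma>_def)
qed

section \<open>Enlarging the family of served frames\<close>

lemma rich_mono: "rich N X u \<Longrightarrow> X \<subseteq> Y \<Longrightarrow> rich N Y u"
proof -
  assume X: "rich N X u" "X \<subseteq> Y"
  obtain b1 b2 where u: "u = (b1, b2)" by (cases u)
  obtain a where a: "N \<le> card {(s,t). a + s *s b1 + t *s b2 \<in> X}" using X(1) by (auto simp: rich_def u)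
  also have "\<dots> \<le> card {(s,t). a + s *s b1 + t *s b2 \<in> Y}" using X(2) by (intro card_mono) auto
  finally show ?thesis by (auto simp: rich_def u)
qed

lemma rich_vimage:
  assumes f: "vlinear f" "bij f" and X: "rich N X (map_prod f f u)"
  shows "rich N (f -` X) u"
proof -
  obtain b1 b2 where u: "u = (b1, b2)" by (cases u)
  obtain a' where a': "N \<le> card {(s,t). a' + s *s f b1 + t *s f b2 \<in> X}" using X by (auto simp: rich_def u)
  obtain a where "a' = f a" using f(2) by (metis bij_pointE)
  then have "a' + s *s f b1 + t *s f b2 = f (a + s *s b1 + t *s b2)" for s t
    by (simp add: vec.linear_add[OF f(1)] vec.linear_scale[OF f(1)])
  with a' show ?thesis by (auto simp: rich_def u)
qed

text \<open>Greedy choice: while fewer than half of the frames are served, some automorphic image of \<open>X\<close> serves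
  at least \<open>|G|/2\<close> new ones.\<close>

lemma rich_amplification:
  fixes X :: "('a::{field,finite}^'n) set"
  assumes G: "G \<subseteq> frames {0}" and rich: "\<And>u. u \<in> G \<Longrightarrow> rich N X u"
  shows "\<exists>(Y :: ('a^'n) set) Q. card Y \<le> m * card X \<and> Q \<subseteq> frames {0} \<and> (\<forall>u\<in>Q. rich N Y u) \<and>
     (card (frames {0} :: (('a^'n) \<times> ('a^'n)) set) \<le> 2 * card Q \<or> m * card G \<le> 2 * card Q)"
proof (induction m)
  case 0
  show ?case by (intro exI[of _ "{}"]) auto
next
  case (Suc m)
  let ?I = "frames {0} :: (('a^'n) \<times> ('a^'n)) set"
  obtain Y Q where YQ: "card Y \<le> m * card X" "Q \<subseteq> ?I" "\<forall>u\<in>Q. rich N Y u"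
    "card ?I \<le> 2 * card Q \<or> m * card G \<le> 2 * card Q" using Suc by blast
  show ?case
  proof (cases "card ?I \<le> 2 * card Q")
    case True
    then show ?thesis using YQ by (intro exI[of _ Y] exI[of _ Q]) auto
  next
    case False
    with YQ(4) have mG: "m * card G \<le> 2 * card Q" by blast
    obtain f where f: "vlinear f" "bij f"
      "card (?I - Q) * card G \<le> card ?I * card {u \<in> ?I - Q. map_prod f f u \<in> G}"
      using frames_average[OF Diff_subset G] by blast
    let ?P = "{u \<in> ?I - Q. map_prod f f u \<in> G}"
    have "card (?I - Q) = card ?I - card Q" using YQ(2) by (simp add: card_Diff_subset)
    then have "card ?I \<le> 2 * card (?I - Q)" using False by linarith
    then have "card ?I * card G \<le> 2 * (card (?I - Q) * card G)"
      unfolding mult.assoc[symmetric] by (rule mult_le_mono1)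
    with f(3) have "card ?I * card G \<le> card ?I * (2 * card ?P)"
      unfolding mult.left_commute[of _ 2] by linarith
    moreover have "card ?I > 0" using False by linarith
    ultimately have "card G \<le> 2 * card ?P" by simp
    moreover have "card (Q \<union> ?P) = card Q + card ?P" by (intro card_Un_disjoint) auto
    ultimately have "Suc m * card G \<le> 2 * card (Q \<union> ?P)" using mG by simp
    moreover have "card (Y \<union> f -` X) \<le> Suc m * card X"
    proof -
      have "card (f -` X) = card X" using f(2) by (intro card_vimage_inj) (auto simp: bij_def)
      then show ?thesis using card_Un_le[of Y "f -` X"] YQ(1) by simp
    qed
    moreover have "rich N (Y \<union> f -` X) u" if "u \<in> Q \<union> ?P" for u
      using that YQ(3) rich_vimage[OF f(1,2)] rich rich_mono by (metis (no_types, lifting) Un_iff Un_upper1 Un_upper2 mem_Collect_eq)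
    ultimately show ?thesis using YQ(2) by (intro exI[of _ "Y \<union> f -` X"] exI[of _ "Q \<union> ?P"]) auto
  qed
qed

section \<open>Cosets of random subspaces\<close>

abbreviation subspaces_in :: "nat \<Rightarrow> ('a::{field,finite}^'n) set \<Rightarrow> ('a^'n) set set" where
  "subspaces_in c W \<equiv> {C \<in> linsubs c. C \<subseteq> W}"

lemma zero_in_linsubs: "C \<in> linsubs c \<Longrightarrow> 0 \<in> C"
  by (simp add: linsubs_def vec.subspace_0)

text \<open>All nonzero vectors of \<open>W\<close> lie in equally many of these subspaces, so
  double counting gives the exact proportion \<open>(q^c - 1) / (q^w - 1)\<close>, weakened to
  \<open>q^c / q^w\<close>.\<close>

lemma card_subspaces_containing:
  fixes W :: "('a::{field,finite}^'n) set"
  assumes W: "W \<in> linsubs w" and v: "v \<in> W" "v \<noteq> 0"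
  shows "CARD('a) ^ w * card {C \<in> subspaces_in c W. v \<in> C} \<le> CARD('a) ^ c * card (subspaces_in c W)"
proof -
  let ?q = "CARD('a)" and ?S = "subspaces_in c W"
  define N where "N v = card {C \<in> ?S. v \<in> C}" for v
  have const: "N v' = N v" if v': "v' \<in> W - {0}" for v'
  proof -
    obtain f where "vlinear f" "bij f" "f ` W = W" "f v = v'"
      using linsubs_transitive(2)[OF W W v, of v'] v' by auto
    then show ?thesis using card_linsubs_within(1)[of f c W v] by (simp add: N_def conj_assoc)
  qed
  have "card (W - {0}) * N v = (\<Sum>v'\<in>W - {0}. N v')" by (simp add: const)
  also have "\<dots> = (\<Sum>v'\<in>W - {0}. \<Sum>C\<in>?S. if v' \<in> C then 1 else 0)"
    unfolding N_def by (simp add: sum.If_cases Int_def)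
  also have "\<dots> = (\<Sum>C\<in>?S. \<Sum>v'\<in>W - {0}. if v' \<in> C then 1 else 0)" by (rule sum.swap)
  also have "\<dots> = (\<Sum>C\<in>?S. ?q ^ c - 1)"
  proof (intro sum.cong refl)
    fix C assume C: "C \<in> ?S"
    then have "(W - {0}) \<inter> C = C - {0}" by auto
    then show "(\<Sum>v'\<in>W - {0}. if v' \<in> C then 1 else 0) = ?q ^ c - 1"
      using C card_subspace[of C c] zero_in_linsubs[of C c] by (simp add: sum.If_cases card_Diff_singleton)
  qed
  finally have eq: "(?q ^ w - 1) * N v = card ?S * (?q ^ c - 1)"
    using card_subspace[OF W] zero_in_linsubs[OF W] by (simp add: card_Diff_singleton)
  \<comment> \<open>Adding \<open>N v\<close> on the left and the larger \<open>card ?S\<close> on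
    the right removes both \<open>- 1\<close>.\<close>
  have "?q ^ w * N v = (?q ^ w - 1) * N v + N v"
    by (cases "?q ^ w") auto
  also have "\<dots> \<le> card ?S * (?q ^ c - 1) + card ?S"
  proof -
    have "N v \<le> card ?S" unfolding N_def by (intro card_mono) auto
    then show ?thesis unfolding eq by simp
  qed
  also have "\<dots> = ?q ^ c * card ?S" by (cases "?q ^ c") auto
  finally show ?thesis by (simp add: N_def)
qed

abbreviation coset :: "'a::ab_group_add set \<Rightarrow> 'a \<Rightarrow> 'a set" where
  "coset C x \<equiv> (\<lambda>y. y + x) ` C"

lemma mem_coset: "p \<in> coset C x \<longleftrightarrow> p - x \<in> C" for p :: "'a::ab_group_add"
  by (auto simp: image_iff intro!: bexI[of _ "p - x"])

lemma diff_linsubs: "C \<in> linsubs c \<Longrightarrow> x \<in> C \<Longrightarrow> y \<in> C \<Longrightarrow> x - y \<in> C"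
  by (simp add: linsubs_def vec.subspace_diff)

lemma card_coset: "card (coset C x) = card C" for C :: "('a::{field,finite}^'n) set"
  by (rule card_image) (simp add: inj_on_def)

lemma card_coset_preimage:
  fixes C W :: "('a::{field,finite}^'n) set"
  assumes C: "C \<in> linsubs c" "C \<subseteq> W" and W: "W \<in> linsubs w" and p: "p \<in> coset W a"
  shows "card {x \<in> coset W a. p - x \<in> C} = CARD('a) ^ c"
proof -
  have "{x \<in> coset W a. p - x \<in> C} = (\<lambda>y. p - y) ` C"
  proof safe
    fix x assume "p - x \<in> C"
    then show "x \<in> (\<lambda>y. p - y) ` C" by (intro image_eqI[of _ _ "p - x"]) auto
  next
    fix y assume "y \<in> C"
    then have "(p - a) - y \<in> W" using C p diff_linsubs[OF W] unfolding mem_coset by blast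
    then show "p - y \<in> coset W a" unfolding mem_coset by (simp add: algebra_simps)
  qed simp
  moreover have "inj_on (\<lambda>y. p - y) C" by (simp add: inj_on_def)
  ultimately show ?thesis using card_subspace[OF C(1)] by (simp add: card_image)
qed

text \<open>For uniform \<open>C\<close> and \<open>x\<close> the count has mean
  \<open>\<mu>\<close> and variance at most \<open>\<mu>\<close>: two distinct points lie together
  in \<open>coset C x\<close> no more often than independent events of probability
  \<open>q^c / q^w\<close>, so only the diagonal pairs contribute. Both sides are left
  unnormalised.\<close>

lemma coset_count_variance:
  fixes W S :: "('a::{field,finite}^'n) set" and a :: "'a^'n" and c :: nat
  assumes W: "W \<in> linsubs w"
  defines "R \<equiv> coset W a" and "Q \<equiv> real CARD('a)"
  defines "s \<equiv> real (card (R \<inter> S))"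
  defines "\<mu> \<equiv> s * Q ^ c / Q ^ w"
  shows "(\<Sum>C\<in>subspaces_in c W. \<Sum>x\<in>R. (real (card (coset C x \<inter> S)) - \<mu>)^2)
           \<le> real (card (subspaces_in c W)) * Q ^ c * s"
proof -
  let ?S = "subspaces_in c W" and ?P = "R \<inter> S"
  have Q: "Q > 0" by (simp add: Q_def)
  have R: "real (card R) = Q ^ w" by (simp add: R_def card_coset card_subspace[OF W] Q_def)
  define i where "i C p x = (if p - x \<in> C then 1 else 0 :: real)" for C and p x :: "'a^'n"
  have ii: "(\<Sum>x\<in>R. i C p x) = Q ^ c" if "C \<in> ?S" "p \<in> R" for C p
    using card_coset_preimage[of C c W w p a] that W
    by (simp add: i_def R_def Q_def sum.If_cases Int_def)
  have cnt: "real (card (coset C x \<inter> S)) = (\<Sum>p\<in>?P. i C p x)" if "C \<in> ?S" "x \<in> R" for C x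
  proof -
    have "p \<in> R" if "p - x \<in> C" for p
    proof -
      have "(p - x) + (x - a) \<in> W"
        using that \<open>C \<in> ?S\<close> \<open>x \<in> R\<close> W unfolding R_def mem_coset
        by (intro vec.subspace_add) (auto simp: linsubs_def)
      then show ?thesis unfolding R_def mem_coset by simp
    qed
    then have "coset C x \<inter> S = {p \<in> ?P. p - x \<in> C}" unfolding set_eq_iff Int_iff mem_coset by auto
    then show ?thesis by (simp add: i_def sum.If_cases Int_def)
  qed
  have first: "(\<Sum>x\<in>R. real (card (coset C x \<inter> S))) = s * Q ^ c" if C: "C \<in> ?S" for C
  proof -
    have "(\<Sum>x\<in>R. real (card (coset C x \<inter> S))) = (\<Sum>x\<in>R. \<Sum>p\<in>?P. i C p x)"
      by (intro sum.cong refl cnt C)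
    also have "\<dots> = (\<Sum>p\<in>?P. \<Sum>x\<in>R. i C p x)" by (rule sum.swap)
    also have "\<dots> = s * Q ^ c" by (simp add: ii[OF C] s_def)
    finally show ?thesis .
  qed
  have second: "(\<Sum>x\<in>R. (real (card (coset C x \<inter> S)))^2) = (\<Sum>p\<in>?P. \<Sum>p'\<in>?P. Q ^ c * i C p p')"
    if C: "C \<in> ?S" for C
  proof -
    \<comment> \<open>Once \<open>p'\<close> lies in the coset, \<open>p\<close> may be compared
      with \<open>p'\<close> instead of with \<open>x\<close>; only one factor then depends on
      \<open>x\<close>, and it sums to \<open>Q ^ c\<close>.\<close>
    have prod: "i C p x * i C p' x = i C p p' * i C p' x" for p p' x
    proof -
      have Cs: "vec.subspace C" using C by (simp add: linsubs_def)
      have "p - x \<in> C \<longleftrightarrow> p - p' \<in> C" if "p' - x \<in> C"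
        using vec.subspace_diff[OF Cs, of "p - x" "p' - x"] vec.subspace_add[OF Cs, of "p - p'" "p' - x"] that
        by auto
      then show ?thesis by (simp add: i_def)
    qed
    have "(\<Sum>x\<in>R. (real (card (coset C x \<inter> S)))^2) = (\<Sum>x\<in>R. \<Sum>p\<in>?P. \<Sum>p'\<in>?P. i C p p' * i C p' x)"
      by (intro sum.cong refl) (simp only: cnt[OF C] power2_eq_square sum_product, intro sum.cong refl prod)
    also have "\<dots> = (\<Sum>p\<in>?P. \<Sum>x\<in>R. \<Sum>p'\<in>?P. i C p p' * i C p' x)" by (rule sum.swap)
    also have "\<dots> = (\<Sum>p\<in>?P. \<Sum>p'\<in>?P. \<Sum>x\<in>R. i C p p' * i C p' x)"
      by (intro sum.cong refl sum.swap)
    also have "\<dots> = (\<Sum>p\<in>?P. \<Sum>p'\<in>?P. Q ^ c * i C p p')"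
      by (intro sum.cong refl) (simp add: sum_distrib_left[symmetric] ii[OF C])
    finally show ?thesis .
  qed
  let ?N = "real (card ?S)"
  have pair: "(\<Sum>C\<in>?S. i C p p') \<le> (if p = p' then ?N else 0) + ?N * Q ^ c / Q ^ w"
    if "p \<in> ?P" "p' \<in> ?P" for p p'
  proof (cases "p = p'")
    case True
    have "(\<Sum>C\<in>?S. i C p p') \<le> (\<Sum>C\<in>?S. 1)" by (intro sum_mono) (simp add: i_def)
    also have "\<dots> \<le> ?N + ?N * Q ^ c / Q ^ w" using Q by simp
    finally show ?thesis using True by simp
  next
    case False
    have "p - p' \<in> W"
      using diff_linsubs[OF W, of "p - a" "p' - a"] that unfolding R_def Int_iff mem_coset by simp
    from card_subspaces_containing[OF W this, of c] False
    have "CARD('a) ^ w * card {C \<in> ?S. p - p' \<in> C} \<le> CARD('a) ^ c * card ?S" by simp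
    from of_nat_mono[OF this, where 'a = real]
    have "Q ^ w * real (card {C \<in> ?S. p - p' \<in> C}) \<le> Q ^ c * ?N"
      by (simp only: Q_def of_nat_mult of_nat_power)
    then have "real (card {C \<in> ?S. p - p' \<in> C}) \<le> ?N * Q ^ c / Q ^ w"
      using Q by (simp add: pos_le_divide_eq mult.commute)
    then show ?thesis using False by (simp add: i_def sum.If_cases Int_def)
  qed
  have "(\<Sum>C\<in>?S. \<Sum>x\<in>R. (real (card (coset C x \<inter> S)))^2) = (\<Sum>C\<in>?S. \<Sum>p\<in>?P. \<Sum>p'\<in>?P. Q ^ c * i C p p')"
    by (intro sum.cong refl second)
  also have "\<dots> = (\<Sum>p\<in>?P. \<Sum>C\<in>?S. \<Sum>p'\<in>?P. Q ^ c * i C p p')" by (rule sum.swap)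
  also have "\<dots> = (\<Sum>p\<in>?P. \<Sum>p'\<in>?P. Q ^ c * (\<Sum>C\<in>?S. i C p p'))"
    unfolding sum_distrib_left by (intro sum.cong refl sum.swap)
  also have "\<dots> \<le> (\<Sum>p\<in>?P. \<Sum>p'\<in>?P. Q ^ c * ((if p = p' then ?N else 0) + ?N * Q ^ c / Q ^ w))"
    using Q by (intro sum_mono mult_left_mono pair) auto
  also have "\<dots> = Q ^ c * (s * ?N + s * (s * (?N * Q ^ c / Q ^ w)))"
    by (simp add: sum_distrib_left[symmetric] sum.distrib s_def distrib_left)
  finally have sq: "(\<Sum>C\<in>?S. \<Sum>x\<in>R. (real (card (coset C x \<inter> S)))^2)
      \<le> Q ^ c * (s * ?N + s * (s * (?N * Q ^ c / Q ^ w)))" .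
  have "(\<Sum>x\<in>R. (real (card (coset C x \<inter> S)) - \<mu>)^2)
      = (\<Sum>x\<in>R. (real (card (coset C x \<inter> S)))^2) - 2 * \<mu> * (s * Q ^ c) + Q ^ w * \<mu>^2" if C: "C \<in> ?S" for C
  proof -
    have "(\<Sum>x\<in>R. (real (card (coset C x \<inter> S)) - \<mu>)^2)
        = (\<Sum>x\<in>R. (real (card (coset C x \<inter> S)))^2 - 2 * \<mu> * real (card (coset C x \<inter> S)) + \<mu>^2)"
      by (intro sum.cong refl) (simp add: power2_diff algebra_simps)
    also have "\<dots> = (\<Sum>x\<in>R. (real (card (coset C x \<inter> S)))^2)
        - 2 * \<mu> * (\<Sum>x\<in>R. real (card (coset C x \<inter> S))) + real (card R) * \<mu>^2"
      by (simp add: sum.distrib sum_subtractf sum_distrib_left)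
    finally show ?thesis by (simp add: first[OF C] R)
  qed
  then have "(\<Sum>C\<in>?S. \<Sum>x\<in>R. (real (card (coset C x \<inter> S)) - \<mu>)^2)
      = (\<Sum>C\<in>?S. (\<Sum>x\<in>R. (real (card (coset C x \<inter> S)))^2) - 2 * \<mu> * (s * Q ^ c) + Q ^ w * \<mu>^2)"
    by (intro sum.cong refl)
  also have "\<dots> = (\<Sum>C\<in>?S. \<Sum>x\<in>R. (real (card (coset C x \<inter> S)))^2) + ?N * (Q ^ w * \<mu>^2 - 2 * \<mu> * (s * Q ^ c))"
    by (simp add: sum.distrib sum_subtractf algebra_simps)
  also have "\<dots> \<le> Q ^ c * (s * ?N + s * (s * (?N * Q ^ c / Q ^ w))) + ?N * (Q ^ w * \<mu>^2 - 2 * \<mu> * (s * Q ^ c))"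
    using sq by simp
  \<comment> \<open>\<open>\<mu>\<close> is such that the terms quadratic in \<open>s\<close>
    cancel, leaving the diagonal.\<close>
  also have "\<dots> = ?N * Q ^ c * s"
    using Q by (simp add: \<mu>_def field_simps power2_eq_square)
  finally show ?thesis .
qed

lemma coset_count_chebyshev:
  fixes W S :: "('a::{field,finite}^'n) set" and a :: "'a^'n" and c :: nat
  assumes W: "W \<in> linsubs w" and D: "D > 0"
  defines "R \<equiv> coset W a" and "Q \<equiv> real CARD('a)"
  defines "s \<equiv> real (card (R \<inter> S))"
  defines "\<mu> \<equiv> s * Q ^ c / Q ^ w"
  shows "(\<Sum>C\<in>subspaces_in c W. real (card {x \<in> R. D \<le> \<bar>real (card (coset C x \<inter> S)) - \<mu>\<bar>}))
           \<le> real (card (subspaces_in c W)) * Q ^ c * s / D^2"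
proof -
  let ?d = "\<lambda>C x. real (card (coset C x \<inter> S)) - \<mu>"
  have "D^2 * real (card {x \<in> R. D \<le> \<bar>?d C x\<bar>}) \<le> (\<Sum>x\<in>R. (?d C x)^2)" for C
  proof -
    have "D^2 * real (card {x \<in> R. D \<le> \<bar>?d C x\<bar>}) = (\<Sum>x\<in>R. if D \<le> \<bar>?d C x\<bar> then D^2 else 0)"
      by (simp add: sum.If_cases Int_def mult.commute)
    also have "\<dots> \<le> (\<Sum>x\<in>R. (?d C x)^2)"
      using D by (intro sum_mono) (auto simp: abs_le_square_iff[symmetric])
    finally show ?thesis .
  qed
  then have "D^2 * (\<Sum>C\<in>subspaces_in c W. real (card {x \<in> R. D \<le> \<bar>?d C x\<bar>}))
      \<le> (\<Sum>C\<in>subspaces_in c W. \<Sum>x\<in>R. (?d C x)^2)"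
    unfolding sum_distrib_left by (intro sum_mono)
  also have "\<dots> \<le> real (card (subspaces_in c W)) * Q ^ c * s"
    using coset_count_variance[OF W, where c = c and a = a and S = S] by (simp add: R_def Q_def s_def \<mu>_def)
  finally show ?thesis using D by (simp add: pos_le_divide_eq mult.commute)
qed

section \<open>Shift-balanced subspaces\<close>

definition unbalanced_points :: "real \<Rightarrow> nat \<Rightarrow> ('a::{field,finite}^'n) set \<Rightarrow> ('a^'n) set \<Rightarrow> ('a^'n) set" where
  "unbalanced_points \<tau> c S C = {x. \<not> balanced \<tau> c S (coset C x)}"

lemma Ek_eq: "c \<le> CARD('n) \<Longrightarrow>
    Ek c (S :: ('a::{field,finite}^'n) set) = real (card S) * real CARD('a) ^ c / real CARD('a) ^ CARD('n)"
  by (simp add: Ek_def power_diff)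

text \<open>The Chebyshev bound for \<open>W = UNIV\<close>, where \<open>\<mu>\<close> is
  \<open>Ek c S\<close>; as a density the bound reads
  \<open>1 / (\<tau>^2 * Ek c S)\<close>.\<close>

lemma unbalanced_points_average:
  fixes S :: "('a::{field,finite}^'n) set"
  assumes c: "c \<le> CARD('n)" and \<tau>: "\<tau> > 0" and e: "Ek c S > 0"
  shows "(\<Sum>C\<in>linsubs c. real (card (unbalanced_points \<tau> c S C)))
       \<le> real (card (linsubs c :: ('a^'n) set set)) * real CARD('a) ^ CARD('n) / (\<tau>^2 * Ek c S)"
proof -
  let ?q = "real CARD('a)" and ?e = "Ek c S" and ?L = "linsubs c :: ('a^'n) set set"
  have "coset UNIV 0 = (UNIV :: ('a^'n) set)" by simp
  have "(\<Sum>C\<in>?L. real (card (unbalanced_points \<tau> c S C)))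
      \<le> (\<Sum>C\<in>?L. real (card {x. \<tau> * ?e \<le> \<bar>real (card (coset C x \<inter> S)) - ?e\<bar>}))"
    unfolding unbalanced_points_def balanced_def
    by (intro sum_mono of_nat_mono card_mono) auto
  also have "\<dots> \<le> real (card ?L) * ?q ^ c * real (card S) / (\<tau> * ?e)^2"
    using coset_count_chebyshev[OF UNIV_linsubs mult_pos_pos[OF \<tau> e], where c = c and a = 0]
    by (simp add: Ek_eq[OF c])
  also have "?q ^ c * real (card S) = ?e * ?q ^ CARD('n)" by (simp add: Ek_eq[OF c])
  then have "real (card ?L) * ?q ^ c * real (card S) / (\<tau> * ?e)^2
      = real (card ?L) * ?q ^ CARD('n) / (\<tau>^2 * ?e)"
    using e \<tau> by (simp add: mult.assoc power2_eq_square field_simps)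
  finally show ?thesis .
qed

text \<open>The Chebyshev bound inside an unbalanced flat: its own mean \<open>\<sigma>\<close> is
  off \<open>Ek c S\<close> by more than \<open>\<tau> * Ek c S\<close>, so a
  \<open>\<tau>/2\<close>-balanced coset deviates from \<open>\<sigma>\<close> by some
  \<open>D\<close>. When \<open>\<sigma>\<close> is the larger one, \<open>D\<close> must grow with
  it to keep \<open>\<sigma> / D^2\<close> bounded, since \<open>\<sigma>\<close> may far exceed
  \<open>Ek c S\<close>.\<close>

lemma unbalanced_flat_balanced_points:
  fixes S A :: "('a::{field,finite}^'n) set"
  assumes A: "A \<in> linsubs (Suc (Suc c))" and c: "Suc (Suc c) \<le> CARD('n)"
    and \<tau>: "\<tau> > 0" and e: "Ek c S > 0" and unb: "\<not> balanced \<tau> (Suc (Suc c)) S (coset A a)"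
  shows "(\<Sum>C\<in>subspaces_in c A. real (card (coset A a - unbalanced_points (\<tau>/2) c S C)))
       \<le> real (card (subspaces_in c A)) * real CARD('a) ^ Suc (Suc c) * (4 * (1 + \<tau>) / (\<tau>^2 * Ek c S))"
proof -
  let ?q = "real CARD('a)" and ?e = "Ek c S" and ?N = "real (card (subspaces_in c A))"
  have q: "?q > 0" by simp
  define s where "s = real (card (coset A a \<inter> S))"
  define \<sigma> where "\<sigma> = s / ?q^2"
  have \<sigma>: "s * ?q ^ c / ?q ^ Suc (Suc c) = \<sigma>" by (simp add: \<sigma>_def power2_eq_square)
  have \<sigma>0: "\<sigma> \<ge> 0" by (simp add: \<sigma>_def s_def)
  have "Ek (Suc (Suc c)) S = ?e * ?q^2"
    using c by (simp add: Ek_eq power2_eq_square)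
  then have "\<tau> * ?e * ?q^2 < \<bar>s - ?e * ?q^2\<bar>"
    using unb by (simp add: balanced_def s_def mult.assoc)
  moreover have "s = \<sigma> * ?q^2" by (simp add: \<sigma>_def)
  then have "\<bar>s - ?e * ?q^2\<bar> = \<bar>\<sigma> - ?e\<bar> * ?q^2"
    by (simp add: left_diff_distrib[symmetric] abs_mult)
  ultimately have unb': "\<tau> * ?e < \<bar>\<sigma> - ?e\<bar>" using q by simp
  have "\<exists>D>0. (\<forall>y. \<bar>y - ?e\<bar> \<le> \<tau>/2 * ?e \<longrightarrow> D \<le> \<bar>y - \<sigma>\<bar>) \<and> \<sigma> / D^2 \<le> 4 * (1 + \<tau>) / (\<tau>^2 * ?e)"
  proof (cases "\<sigma> > ?e")
    case True
    then have big: "\<sigma> > (1 + \<tau>) * ?e" using unb' by (simp add: distrib_right)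
    have "?e < \<sigma> / (1 + \<tau>)" using big \<tau> by (simp add: pos_less_divide_eq mult.commute)
    \<comment> \<open>Since \<open>?e < \<sigma> / (1 + \<tau>)\<close>, a balanced count is at most
      \<open>\<sigma> * (1 + \<tau>/2) / (1 + \<tau>)\<close>, which is
      \<open>\<sigma> - D\<close>.\<close>
    define D where "D = \<sigma> * (\<tau> / (2 * (1 + \<tau>)))"
    have \<sigma>p: "\<sigma> > 0" using True e by linarith
    have D: "D > 0" using \<tau> \<sigma>p by (simp add: D_def)
    have "D \<le> \<bar>y - \<sigma>\<bar>" if "\<bar>y - ?e\<bar> \<le> \<tau>/2 * ?e" for y
    proof -
      have "y \<le> (1 + \<tau>/2) * ?e" using abs_le_D1[OF that] by (simp add: distrib_right)
      also have "\<dots> \<le> (1 + \<tau>/2) * (\<sigma> / (1 + \<tau>))"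
        using \<open>?e < \<sigma> / (1 + \<tau>)\<close> \<tau> by (intro mult_left_mono) auto
      also have "\<dots> = \<sigma> - D" using \<tau> by (simp add: D_def field_simps)
      finally show ?thesis by linarith
    qed
    moreover have "\<sigma> / D^2 \<le> 4 * (1 + \<tau>) / (\<tau>^2 * ?e)"
    proof -
      have "\<sigma> / D^2 = 4 * (1 + \<tau>) / (\<tau>^2 * (\<sigma> / (1 + \<tau>)))"
        using \<tau> \<sigma>p by (simp add: D_def power2_eq_square field_simps)
      also have "\<dots> \<le> 4 * (1 + \<tau>) / (\<tau>^2 * ?e)"
        using \<open>?e < \<sigma> / (1 + \<tau>)\<close> \<tau> e by (intro divide_left_mono mult_left_mono mult_pos_pos) auto
      finally show ?thesis .
    qed
    ultimately show ?thesis using D by blast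
  next
    case False
    then have small: "\<sigma> < (1 - \<tau>) * ?e" using unb' by (simp add: left_diff_distrib)
    \<comment> \<open>The gap between \<open>(1 - \<tau>) * ?e\<close> and
      \<open>(1 - \<tau>/2) * ?e\<close>. Bounding \<open>\<sigma>\<close> generously by
      \<open>(1 + \<tau>) * ?e\<close> then gives the same estimate as in the other case.\<close>
    define D where "D = \<tau>/2 * ?e"
    have D: "D > 0" using \<tau> e by (simp add: D_def)
    have "D \<le> \<bar>y - \<sigma>\<bar>" if "\<bar>y - ?e\<bar> \<le> \<tau>/2 * ?e" for y
    proof -
      have "(1 - \<tau>/2) * ?e \<le> y" using abs_le_D2[OF that] by (simp add: left_diff_distrib)
      moreover have "(1 - \<tau>/2) * ?e - (1 - \<tau>) * ?e = D" by (simp add: D_def left_diff_distrib)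
      ultimately show ?thesis using small by linarith
    qed
    moreover have "\<sigma> / D^2 \<le> 4 * (1 + \<tau>) / (\<tau>^2 * ?e)"
    proof -
      have "\<sigma> / D^2 \<le> ((1 + \<tau>) * ?e) / D^2"
      proof (rule divide_right_mono)
        have "(1 - \<tau>) * ?e \<le> (1 + \<tau>) * ?e" using \<tau> e by (intro mult_right_mono) auto
        then show "\<sigma> \<le> (1 + \<tau>) * ?e" using small by linarith
      qed simp
      also have "\<dots> = 4 * (1 + \<tau>) / (\<tau>^2 * ?e)" using e by (simp add: D_def power2_eq_square mult_ac)
      finally show ?thesis .
    qed
    ultimately show ?thesis using D by blast
  qed
  then obtain D where D: "D > 0" "\<And>y. \<bar>y - ?e\<bar> \<le> \<tau>/2 * ?e \<Longrightarrow> D \<le> \<bar>y - \<sigma>\<bar>"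
    "\<sigma> / D^2 \<le> 4 * (1 + \<tau>) / (\<tau>^2 * ?e)" by blast
  have "(\<Sum>C\<in>subspaces_in c A. real (card (coset A a - unbalanced_points (\<tau>/2) c S C)))
      \<le> (\<Sum>C\<in>subspaces_in c A. real (card {x \<in> coset A a. D \<le> \<bar>real (card (coset C x \<inter> S)) - \<sigma>\<bar>}))"
  proof (intro sum_mono of_nat_mono card_mono)
    show "coset A a - unbalanced_points (\<tau>/2) c S C
        \<subseteq> {x \<in> coset A a. D \<le> \<bar>real (card (coset C x \<inter> S)) - \<sigma>\<bar>}" for C
      using D(2) unfolding unbalanced_points_def balanced_def by blast
  qed simp
  also have "\<dots> \<le> ?N * ?q ^ c * s / D^2"
    using coset_count_chebyshev[OF A D(1), where c = c and a = a and S = S]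
    unfolding s_def[symmetric] \<sigma> .
  also have "\<dots> = ?N * ?q ^ Suc (Suc c) * (\<sigma> / D^2)"
    by (simp add: \<sigma>_def power2_eq_square)
  also have "\<dots> \<le> ?N * ?q ^ Suc (Suc c) * (4 * (1 + \<tau>) / (\<tau>^2 * ?e))"
    using D(3) by (intro mult_left_mono) auto
  finally show ?thesis .
qed

text \<open>The flat splits into translates of \<open>C\<close> by the \<open>q^2\<close> points of
  the plane. By invariance a point of the plane outside \<open>X\<close> loses its whole translate,
  \<open>q^c\<close> points, so \<open>m\<close> times the number of lost parameters is at most
  \<open>q^2\<close>.\<close>

lemma full_plane_in_full_flat:
  fixes C X :: "('a::{field,finite}^'n) set"
  assumes C: "C \<in> linsubs c" and b: "(b1, b2) \<in> frames C"
    and inv: "\<And>x y. y \<in> C \<Longrightarrow> x + y \<in> X \<Longrightarrow> x \<in> X"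
    and full: "m * card (coset (vec.span (insert b2 (insert b1 C))) a - X) \<le> CARD('a) ^ Suc (Suc c)"
  shows "(m - 1) * CARD('a)^2 \<le> m * card {(s,t). a + s *s b1 + t *s b2 \<in> X}"
proof -
  let ?A = "vec.span (insert b2 (insert b1 C))" and ?q = "CARD('a)"
  let ?Good = "{(s,t). a + s *s b1 + t *s b2 \<in> X}"
  have Cs: "vec.subspace C" using C by (simp add: linsubs_def)
  have b1: "b1 \<notin> C" and b2: "b2 \<notin> vec.span (insert b1 C)" using b by (auto simp: frames_def)
  let ?h = "\<lambda>((s, t), y). a + s *s b1 + t *s b2 + y"
  have "inj_on ?h ((- ?Good) \<times> C)"
  proof (rule inj_onI)
    fix p p' assume pp: "p \<in> (- ?Good) \<times> C" "p' \<in> (- ?Good) \<times> C" "?h p = ?h p'"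
    obtain s t y s' t' y' where p: "p = ((s, t), y)" "p' = ((s', t'), y')" by (metis prod.exhaust)
    have y: "y \<in> C" "y' \<in> C" using pp by (auto simp: p)
    have eq: "s *s b1 + t *s b2 + y = s' *s b1 + t' *s b2 + y'"
      using pp(3) by (simp add: p add.assoc)
    have scale: "v \<in> vec.span V" if "d \<noteq> 0" "d *s v \<in> vec.span V" for d :: 'a and v and V :: "('a^'n) set"
    proof -
      have "inverse d *s (d *s v) \<in> vec.span V" using that(2) by (rule vec.span_scale)
      then show ?thesis using that(1) by (simp add: vector_smult_assoc)
    qed
    have t: "t = t'"
    proof (rule ccontr)
      assume "t \<noteq> t'"
      have "(t - t') *s b2 = (s' - s) *s b1 + (y' - y)"
        using eq by (simp add: vec.scale_left_diff_distrib algebra_simps)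
      also have "\<dots> \<in> vec.span (insert b1 C)"
        using y by (intro vec.span_add vec.span_scale vec.span_diff) (auto intro: vec.span_base)
      finally have "(t - t') *s b2 \<in> vec.span (insert b1 C)" .
      moreover have "t - t' \<noteq> 0" using \<open>t \<noteq> t'\<close> by simp
      ultimately have "b2 \<in> vec.span (insert b1 C)" by (rule scale[rotated])
      with b2 show False by contradiction
    qed
    have s: "s = s'"
    proof (rule ccontr)
      assume "s \<noteq> s'"
      have "(s - s') *s b1 = y' - y"
        using eq t by (simp add: vec.scale_left_diff_distrib algebra_simps)
      also have "\<dots> \<in> vec.span C" using y by (intro vec.span_diff) (auto intro: vec.span_base)
      finally have "(s - s') *s b1 \<in> vec.span C" .
      moreover have "s - s' \<noteq> 0" using \<open>s \<noteq> s'\<close> by simp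
      ultimately have "b1 \<in> vec.span C" by (rule scale[rotated])
      with b1 show False unfolding span_subspace[OF C] by contradiction
    qed
    show "p = p'" using s t eq by (simp add: p)
  qed
  moreover have "?h ` ((- ?Good) \<times> C) \<subseteq> coset ?A a - X"
  proof (rule image_subsetI)
    fix p assume p': "p \<in> (- ?Good) \<times> C"
    obtain s t y where p: "p = ((s, t), y)" by (metis prod.exhaust)
    then have st: "(s, t) \<notin> ?Good" "y \<in> C" using p' by auto
    have "s *s b1 + t *s b2 + y \<in> ?A"
      using st(2) by (intro vec.span_add vec.span_scale) (auto intro: vec.span_base)
    then have "a + s *s b1 + t *s b2 + y \<in> coset ?A a"
      unfolding mem_coset by (simp add: algebra_simps)
    then show "?h p \<in> coset ?A a - X"
      using st inv[of y "a + s *s b1 + t *s b2"] by (auto simp: p)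
  qed
  ultimately have "card ((- ?Good) \<times> C) \<le> card (coset ?A a - X)" by (intro card_inj_on_le) auto
  then have "m * card ((- ?Good) \<times> C) \<le> ?q ^ Suc (Suc c)"
    using full by (meson mult_le_mono2 le_trans)
  then have "m * (card (- ?Good) * ?q ^ c) \<le> ?q ^ Suc (Suc c)"
    by (simp only: card_cartesian_product card_subspace[OF C])
  then have "(m * card (- ?Good)) * ?q ^ c \<le> ?q^2 * ?q ^ c"
    by (simp add: power2_eq_square mult.assoc)
  then have "m * card (- ?Good) \<le> ?q^2" by simp
  moreover have "card ?Good + card (- ?Good) = ?q^2"
    using card_Un_disjoint[of ?Good "- ?Good"] by (simp add: power2_eq_square)
  then have "m * card ?Good + m * card (- ?Good) = m * ?q^2"
    unfolding distrib_left[symmetric] by (rule arg_cong)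
  ultimately show ?thesis by (simp add: diff_mult_distrib)
qed

text \<open>Double counting of flags \<open>C \<subseteq> A\<close>: a frame of \<open>C\<close>
  determines its span \<open>A\<close>, and each flag arises from the same number of frames, those
  lying in \<open>A\<close>.\<close>

lemma sum_frames_over_flags:
  fixes P :: "('a::{field,finite}^'n) set \<Rightarrow> ('a^'n) set \<Rightarrow> bool"
  shows "(\<Sum>C\<in>linsubs c. card {(b1, b2) \<in> frames C. P (vec.span (insert b2 (insert b1 C))) C})
    = (CARD('a) ^ Suc (Suc c) - CARD('a) ^ c) * (CARD('a) ^ Suc (Suc c) - CARD('a) ^ Suc c)
       * (\<Sum>A\<in>linsubs (Suc (Suc c)). card {C \<in> subspaces_in c A. P A C})"
proof -
  let ?k = "Suc (Suc c)"
  let ?w = "(CARD('a) ^ ?k - CARD('a) ^ c) * (CARD('a) ^ ?k - CARD('a) ^ Suc c)"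
  let ?sp = "\<lambda>C b. vec.span (insert (snd b) (insert (fst b) C))"
  have "card {(b1, b2) \<in> frames C. P (vec.span (insert b2 (insert b1 C))) C}
      = (\<Sum>A\<in>linsubs ?k. if C \<subseteq> A \<and> P A C then ?w else 0)" if C: "C \<in> linsubs c" for C :: "('a^'n) set"
  proof -
    let ?F = "{b \<in> frames C. P (?sp C b) C}"
    have "{(b1, b2) \<in> frames C. P (vec.span (insert b2 (insert b1 C))) C} = ?F" by auto
    then have "card {(b1, b2) \<in> frames C. P (vec.span (insert b2 (insert b1 C))) C} = (\<Sum>b\<in>?F. 1)" by simp
    also have "\<dots> = (\<Sum>A\<in>linsubs ?k. \<Sum>b\<in>{b \<in> ?F. ?sp C b = A}. 1)"
      by (rule sum.group[symmetric]) (use frame_span_linsubs[OF C] in auto)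
    also have "\<dots> = (\<Sum>A\<in>linsubs ?k. if C \<subseteq> A \<and> P A C then ?w else 0)"
    proof (intro sum.cong refl)
      fix A :: "('a^'n) set" assume A: "A \<in> linsubs ?k"
      have iff: "?sp C b = A \<longleftrightarrow> C \<subseteq> A \<and> b \<in> A \<times> A" if "b \<in> frames C" for b
        using frames_span_eq_iff[OF C A, of "fst b" "snd b"] that by (auto simp: mem_Times_iff)
      show "(\<Sum>b\<in>{b \<in> ?F. ?sp C b = A}. 1) = (if C \<subseteq> A \<and> P A C then ?w else 0)"
      proof (cases "C \<subseteq> A \<and> P A C")
        case True
        then have "{b \<in> ?F. ?sp C b = A} = frames C \<inter> A \<times> A" using iff by auto
        then show ?thesis using card_frames_within[OF C _ A] True by simp
      next
        case False
        have "C \<subseteq> A \<and> P A C" if "b \<in> frames C" "P (?sp C b) C" "?sp C b = A" for b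
          using iff[OF that(1)] that(2,3) by blast
        with False have "{b \<in> ?F. ?sp C b = A} = {}" by blast
        then show ?thesis unfolding if_not_P[OF False] by (simp only: sum.empty)
      qed
    qed
    finally show ?thesis .
  qed
  then have "(\<Sum>C\<in>linsubs c. card {(b1, b2) \<in> frames C. P (vec.span (insert b2 (insert b1 C))) C})
      = (\<Sum>C\<in>linsubs c. \<Sum>A\<in>linsubs ?k. if C \<subseteq> A \<and> P A C then ?w else 0)" by simp
  also have "\<dots> = (\<Sum>A\<in>linsubs ?k. \<Sum>C\<in>linsubs c. if C \<subseteq> A \<and> P A C then ?w else 0)" by (rule sum.swap)
  also have "\<dots> = (\<Sum>A\<in>linsubs ?k. ?w * card {C \<in> subspaces_in c A. P A C})"
  proof (intro sum.cong refl)
    fix A :: "('a^'n) set"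
    have "linsubs c \<inter> {C. C \<subseteq> A \<and> P A C} = {C \<in> subspaces_in c A. P A C}" by auto
    then show "(\<Sum>C\<in>linsubs c. if C \<subseteq> A \<and> P A C then ?w else 0) = ?w * card {C \<in> subspaces_in c A. P A C}"
      by (simp add: sum.If_cases mult.commute)
  qed
  finally show ?thesis by (simp only: sum_distrib_left)
qed

text \<open>From \<open>4 q^(c+1) \<le> q^n\<close> each factor is at least \<open>3/4\<close> of
  \<open>q^n\<close>, and \<open>9/16 \<ge> 1/2\<close>.\<close>

lemma frames_majority:
  fixes q :: nat
  assumes "4 \<le> q" "c + 2 \<le> n"
  shows "q ^ (2 * n) \<le> 2 * ((q ^ n - q ^ c) * (q ^ n - q ^ Suc c))"
proof -
  have "4 * q ^ Suc c \<le> q * q ^ Suc c" using assms by (intro mult_le_mono1)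
  also have "\<dots> \<le> q ^ n" using assms power_increasing[of "Suc (Suc c)" n q] by simp
  finally have 1: "4 * q ^ Suc c \<le> q ^ n" .
  have "q ^ c \<le> q ^ Suc c" using assms by simp
  then have "3 * q ^ n \<le> 4 * (q ^ n - q ^ c)" "3 * q ^ n \<le> 4 * (q ^ n - q ^ Suc c)"
    using 1 by linarith+
  then have "(3 * q ^ n) * (3 * q ^ n) \<le> (4 * (q ^ n - q ^ c)) * (4 * (q ^ n - q ^ Suc c))"
    by (rule mult_le_mono)
  moreover have "q ^ (2 * n) = q ^ n * q ^ n" by (simp add: mult_2 power_add)
  ultimately show ?thesis by simp
qed

lemma frames_subset_frames_zero: "C \<in> linsubs c \<Longrightarrow> frames C \<subseteq> frames {0}"
proof -
  assume C: "C \<in> linsubs c"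
  have "vec.span (insert b1 {0}) \<subseteq> vec.span (insert b1 C)" for b1
    using zero_in_linsubs[OF C] by (intro vec.span_mono) auto
  then show ?thesis using zero_in_linsubs[OF C] by (auto simp: frames_def)
qed

lemma unbalanced_points_invariant:
  assumes C: "C \<in> linsubs c" and y: "y \<in> C" and "x + y \<in> unbalanced_points \<tau> c' S C"
  shows "x \<in> unbalanced_points \<tau> c' S C"
proof -
  have Cs: "vec.subspace C" using C by (simp add: linsubs_def)
  have "p - (x + y) \<in> C \<longleftrightarrow> p - x \<in> C" for p
    using vec.subspace_add[OF Cs _ y, of "p - (x + y)"] vec.subspace_diff[OF Cs _ y, of "p - x"]
    by (auto simp: algebra_simps)
  then have "coset C (x + y) = coset C x" unfolding set_eq_iff mem_coset by blast
  then show ?thesis using assms(3) by (simp add: unbalanced_points_def)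
qed

text \<open>About \<open>card (frames {0}) / card G\<close> copies of \<open>X\<close> serve half of
  the independent pairs, so \<open>kakeya_planes\<close> applies to their union. The constant is
  \<open>10 = 5/2 * 2 * 2\<close>: the density \<open>2/5\<close>, the rounding of the number of
  copies, and the share of \<open>frames C\<close> among all pairs.\<close>

lemma rich_frames_bound:
  fixes C X :: "('a::{field,finite}^'n) set" and G :: "(('a^'n) \<times> ('a^'n)) set"
  assumes q: "32 * CARD('n) \<le> CARD('a)" and n: "2 \<le> CARD('n)"
    and C: "C \<in> linsubs c" "c + 2 \<le> CARD('n)" and G: "G \<subseteq> frames C" "G \<noteq> {}"
    and N: "(4 * CARD('n) - 1) * CARD('a)^2 \<le> 4 * CARD('n) * N"
    and rich: "\<And>b. b \<in> G \<Longrightarrow> rich N X b"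
  shows "CARD('a) ^ CARD('n) * card G \<le> 10 * card (frames C) * card X"
proof (rule ccontr)
  let ?q = "CARD('a)" and ?n = "CARD('n)"
  let ?I = "frames {0} :: (('a^'n) \<times> ('a^'n)) set"
  assume "\<not> ?thesis"
  then have big: "10 * card (frames C) * card X < ?q ^ ?n * card G" by simp
  have q4: "4 \<le> ?q" using q n by linarith
  have cF: "?q ^ (2 * ?n) \<le> 2 * card (frames C)"
    using frames_majority[OF q4 C(2)] by (simp add: card_frames[OF C(1)])
  have cI: "?q ^ (2 * ?n) \<le> 2 * card ?I"
    using frames_majority[OF q4, of 0 ?n] n by (simp add: card_frames[OF zero_linsubs])
  have I_le: "card ?I \<le> ?q ^ (2 * ?n)"
  proof -
    have "card ?I \<le> card (UNIV :: (('a^'n) \<times> ('a^'n)) set)" by (intro card_mono) auto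
    also have "\<dots> = ?q ^ (2 * ?n)" by (simp add: card_cartesian_product mult_2 power_add)
    finally show ?thesis .
  qed
  have GI: "G \<subseteq> ?I" using G frames_subset_frames_zero[OF C(1)] by blast
  then have G_le: "card G \<le> card ?I" by (intro card_mono) auto
  have G0: "card G > 0" using G(2) by (simp add: card_gt_0_iff)
  \<comment> \<open>Rounded up to ensure \<open>card ?I \<le> m * card G\<close>; as
    \<open>card G \<le> card ?I\<close>, the rounding costs at most a factor 2.\<close>
  define m where "m = card ?I div card G + 1"
  have m: "card ?I \<le> m * card G" "m * card G \<le> 2 * card ?I"
  proof -
    have "card ?I = card ?I div card G * card G + card ?I mod card G" by simp
    moreover have "card ?I mod card G < card G" using G0 by simp
    moreover have "m * card G = card ?I div card G * card G + card G" by (simp add: m_def)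
    ultimately show "card ?I \<le> m * card G" "m * card G \<le> 2 * card ?I"
      using G_le by linarith+
  qed
  obtain Y Q where Y: "card Y \<le> m * card X" and Q: "Q \<subseteq> ?I" "\<forall>u\<in>Q. rich N Y u"
    "card ?I \<le> 2 * card Q \<or> m * card G \<le> 2 * card Q"
    using rich_amplification[OF GI rich, where m = m] by blast
  have "card ?I \<le> 2 * card Q" using Q(3) m(1) by linarith
  \<comment> \<open>Half of the independent pairs, themselves at least half of all pairs: the
    density \<open>1/4\<close> that \<open>kakeya_planes\<close> expects.\<close>
  then have "?q ^ (2 * ?n) \<le> 4 * card Q" using cI by linarith
  then have "2 * ?q ^ ?n < 5 * card Y"
    by (rule kakeya_planes[OF q _ N]) (use Q(2) in blast)
  then have "2 * ?q ^ ?n < 5 * (m * card X)" using Y by linarith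
  then have "card G * (2 * ?q ^ ?n) \<le> card G * (5 * (m * card X))" by (intro mult_le_mono2) simp
  also have "\<dots> = (m * card G) * (5 * card X)" by simp
  also have "\<dots> \<le> (2 * card ?I) * (5 * card X)" by (rule mult_le_mono1[OF m(2)])
  also have "\<dots> \<le> (2 * (2 * card (frames C))) * (5 * card X)"
    using I_le cF by (intro mult_le_mono1 mult_le_mono2) linarith
  also have "\<dots> = 2 * (10 * card (frames C) * card X)" by simp
  finally show False using big by (simp add: mult_ac)
qed

section \<open>Markov's inequality and the final averaging\<close>

lemma card_linsubs_pos:
  assumes "c \<le> CARD('n)"
  shows "card (linsubs c :: ('a::{field,finite}^'n) set set) > 0"
proof -
  have "vec.dim (UNIV :: ('a^'n) set) = CARD('n)" using UNIV_linsubs by (auto simp: linsubs_def)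
  then obtain T :: "('a^'n) set" where "vec.subspace T" "vec.dim T = c"
    using vec.choose_subspace_of_subspace[of c UNIV] assms by metis
  then show ?thesis by (auto simp: card_gt_0_iff linsubs_def)
qed

text \<open>Markov's inequality for \<open>unbalanced_flat_balanced_points\<close>: the missed
  proportion, multiplied by \<open>m\<close>, has mean at most \<open>1/2\<close>, so it exceeds 1
  for at most half of the subspaces.\<close>

lemma good_subspaces_majority:
  fixes S A :: "('a::{field,finite}^'n) set"
  assumes A: "A \<in> linsubs (Suc (Suc c))" and c: "Suc (Suc c) \<le> CARD('n)"
    and \<tau>: "\<tau> > 0" and e: "Ek c S > 0" and unb: "\<not> balanced \<tau> (Suc (Suc c)) S (coset A a)"
    and m: "m * (4 * (1 + \<tau>) / (\<tau>^2 * Ek c S)) \<le> 1/2" "m > 0"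
  shows "real (card (subspaces_in c A)) \<le> 2 * real (card {C \<in> subspaces_in c A.
     m * real (card (coset A a - unbalanced_points (\<tau>/2) c S C)) \<le> real CARD('a) ^ Suc (Suc c)})"
proof -
  let ?Q = "real CARD('a) ^ Suc (Suc c)" and ?S = "subspaces_in c A"
  let ?f = "\<lambda>C. real (card (coset A a - unbalanced_points (\<tau>/2) c S C))"
  let ?bad = "{C \<in> ?S. \<not> m * ?f C \<le> ?Q}"
  have Q: "?Q > 0" by simp
  have "?Q * real (card ?bad) = (\<Sum>C\<in>?bad. ?Q)" by simp
  also have "\<dots> \<le> (\<Sum>C\<in>?bad. m * ?f C)" by (intro sum_mono) auto
  also have "\<dots> \<le> (\<Sum>C\<in>?S. m * ?f C)" using m(2) by (intro sum_mono2) auto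
  also have "\<dots> = m * (\<Sum>C\<in>?S. ?f C)" by (simp add: sum_distrib_left)
  also have "\<dots> \<le> m * (real (card ?S) * ?Q * (4 * (1 + \<tau>) / (\<tau>^2 * Ek c S)))"
    using m(2) unbalanced_flat_balanced_points[OF A c \<tau> e unb] by (intro mult_left_mono) auto
  also have "\<dots> = (real (card ?S) * ?Q) * (m * (4 * (1 + \<tau>) / (\<tau>^2 * Ek c S)))" by simp
  also have "\<dots> \<le> (real (card ?S) * ?Q) * (1/2)" using m(1) by (intro mult_left_mono) auto
  finally have "?Q * (2 * real (card ?bad)) \<le> ?Q * real (card ?S)" by simp
  then have "2 * real (card ?bad) \<le> real (card ?S)" using Q by (simp only: mult_le_cancel_left_pos)
  moreover have "card ?S = card {C \<in> ?S. m * ?f C \<le> ?Q} + card ?bad"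
  proof -
    have "{C \<in> ?S. m * ?f C \<le> ?Q} \<union> ?bad = ?S" by blast
    moreover have "card ({C \<in> ?S. m * ?f C \<le> ?Q} \<union> ?bad) = card {C \<in> ?S. m * ?f C \<le> ?Q} + card ?bad"
      by (rule card_Un_disjoint) auto
    ultimately show ?thesis by (simp only:)
  qed
  ultimately show ?thesis by linarith
qed

theorem mainTheorem8:
  fixes S :: "('a::{field,finite}^'n) set"
    and \<tau> \<delta> :: real and r k :: nat
  assumes "CARD('n) \<ge> 5"
    and "card S > CARD('a) ^ 4"
    and "\<tau> > 0" and "0 < \<delta>" and "\<delta> < 1"
    and "real CARD('a) \<ge> 32 * max (real CARD('n) * (1 + \<tau>) / (\<tau> * \<delta>)^2) (real CARD('n))"
    and "4 \<le> r" and "r \<le> CARD('n) - 1"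
    and "CARD('a) ^ r < card S" and "card S \<le> CARD('a) ^ (r + 1)"
    and "k = CARD('n) - r + 3"
  shows "real (card {A \<in> (linsubs k :: ('a^'n) set set). shift_balanced \<tau> k S A})
           \<ge> (1 - \<delta>) * real (card (linsubs k :: ('a^'n) set set))"
proof (rule ccontr)
  assume contra: "\<not> ?thesis"
  let ?q = "CARD('a)" and ?n = "CARD('n)"
  \<comment> \<open>With this choice \<open>n - c = r - 1\<close>, so \<open>card S > q^r\<close>
    becomes \<open>e > q\<close> below.\<close>
  define c where "c = ?n - r + 1"
  have k: "k = Suc (Suc c)" using assms(11) by (simp add: c_def)
  have c: "Suc (Suc c) \<le> ?n" "c + 2 \<le> ?n" "c \<le> ?n" using assms(1,7,8) by (simp_all add: c_def)
  let ?\<A> = "linsubs k :: ('a^'n) set set" and ?\<C> = "linsubs c :: ('a^'n) set set"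
  define e where "e = Ek c S"
  have qe: "real ?q < e"
  proof -
    have "?n - c = r - 1" using assms(1,7,8) by (simp add: c_def)
    then have "e = real (card S) / real ?q ^ (r - 1)" by (simp add: e_def Ek_def)
    moreover have "real ?q * real ?q ^ (r - 1) = real (?q ^ r)"
      using assms(7) by (cases r) auto
    moreover have "real (?q ^ r) < real (card S)" using assms(9) by (simp only: of_nat_less_iff)
    ultimately show ?thesis by (simp add: pos_less_divide_eq)
  qed
  then have e: "e > 0" by (meson le_less_trans of_nat_0_le_iff)
  have q: "32 * ?n \<le> ?q"
  proof -
    have "32 * real ?n \<le> real ?q" using assms(6) by linarith
    then show ?thesis by linarith
  qed
  \<comment> \<open>A common bound for the average density of \<open>X\<close> and for the average
    proportion of an unbalanced flat outside \<open>X\<close>. It is used twice: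
    \<open>4 n * h \<le> 1/2\<close> for Markov's inequality, and \<open>10 * h < \<delta>/2\<close>
    for the final contradiction.\<close>
  define h where "h = 4 * (1 + \<tau>) / (\<tau>^2 * e)"
  have h: "h \<le> \<delta>^2 / (8 * real ?n)"
  proof -
    have "32 * (real ?n * (1 + \<tau>) / (\<tau> * \<delta>)^2) \<le> real ?q" using assms(6) by linarith
    then have "32 * (real ?n * (1 + \<tau>) / (\<tau> * \<delta>)^2) \<le> e" using qe by linarith
    then have "32 * (real ?n * (1 + \<tau>)) \<le> e * (\<tau> * \<delta>)^2"
      using assms(3,4) by (simp add: field_simps)
    then show ?thesis using assms(3,4) e by (simp add: h_def field_simps power_mult_distrib)
  qed
  have \<delta>2: "\<delta>^2 \<le> \<delta>" using assms(4,5) by (simp add: power2_eq_square mult_left_le)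
  define X where "X C = unbalanced_points (\<tau>/2) c S C" for C
  have X: "(\<Sum>C\<in>?\<C>. real (card (X C))) \<le> real (card ?\<C>) * real ?q ^ ?n * h"
  proof -
    have "(\<Sum>C\<in>?\<C>. real (card (X C))) \<le> real (card ?\<C>) * real ?q ^ ?n / ((\<tau>/2)^2 * e)"
      unfolding X_def e_def using assms(3) e
      by (intro unbalanced_points_average[OF c(3)]) (simp_all add: e_def)
    also have "\<dots> = (real (card ?\<C>) * real ?q ^ ?n) * (4 * 1 / (\<tau>^2 * e))"
      by (simp add: power_divide)
    also have "\<dots> \<le> (real (card ?\<C>) * real ?q ^ ?n) * h"
      unfolding h_def using assms(3) e by (intro mult_left_mono divide_right_mono) auto
    finally show ?thesis .
  qed
  define \<B> where "\<B> = {A \<in> ?\<A>. \<not> shift_balanced \<tau> k S A}"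
  have \<B>: "\<delta> * real (card ?\<A>) < real (card \<B>)"
  proof -
    have "\<B> = ?\<A> - {A \<in> ?\<A>. shift_balanced \<tau> k S A}" by (auto simp: \<B>_def)
    then have "card \<B> = card ?\<A> - card {A \<in> ?\<A>. shift_balanced \<tau> k S A}"
      by (simp add: card_Diff_subset)
    moreover have "card {A \<in> ?\<A>. shift_balanced \<tau> k S A} \<le> card ?\<A>" by (intro card_mono) auto
    ultimately show ?thesis using contra by (simp add: of_nat_diff algebra_simps)
  qed
  have "\<exists>a. \<not> balanced \<tau> k S (coset A a)" if "A \<in> \<B>" for A
    using that by (auto simp: \<B>_def shift_balanced_def)
  then obtain a where a: "\<And>A. A \<in> \<B> \<Longrightarrow> \<not> balanced \<tau> k S (coset A (a A))" by metis
  \<comment> \<open>A flat may miss a fraction \<open>1/(4n)\<close> of its points, which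
    \<open>kakeya_planes\<close> tolerates on planes. The translate \<open>a A\<close> is fixed
    beforehand, so that \<open>good\<close> is a relation between subspaces only, as
    \<open>sum_frames_over_flags\<close> requires.\<close>
  define good where "good A C \<longleftrightarrow> A \<in> \<B> \<and> 4 * ?n * card (coset A (a A) - X C) \<le> ?q ^ k" for A C
  obtain A0 :: "('a^'n) set" where A0: "A0 \<in> linsubs k"
    using card_linsubs_pos[of k, where ?'a = 'a and ?'n = 'n] c k by (auto simp: card_gt_0_iff)
  define N1 where "N1 = card (subspaces_in c A0)"
  have N1: "card (subspaces_in c A) = N1" if "A \<in> linsubs k" for A :: "('a^'n) set"
    using linsubs_transitive(1)[OF A0 that] card_linsubs_within(2)[of _ c A0] by (auto simp: N1_def)
  define w where "w = (?q ^ k - ?q ^ c) * (?q ^ k - ?q ^ Suc c)"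
  define F where "F = (?q ^ ?n - ?q ^ c) * (?q ^ ?n - ?q ^ Suc c)"
  let ?sp = "\<lambda>C b1 b2. vec.span (insert b2 (insert b1 C))"
  define G where "G C = {(b1, b2) \<in> frames C. good (?sp C b1 b2) C}" for C
  have total: "card ?\<C> * F = w * (card ?\<A> * N1)"
  proof -
    have "card ?\<C> * F = (\<Sum>C\<in>?\<C>. card (frames C))" by (simp add: card_frames F_def)
    also have "\<dots> = w * (\<Sum>A\<in>?\<A>. card (subspaces_in c A))"
      using sum_frames_over_flags[of "\<lambda>(_ :: ('a^'n) set) _. True" c] by (simp add: w_def k)
    finally show ?thesis by (simp add: N1)
  qed
  \<comment> \<open>More than a proportion \<open>\<delta>\<close> of the \<open>A\<close> is bad,
    and at least half of the \<open>C\<close> inside each of them is good; uniformity of flags turns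
    this into a proportion \<open>\<delta>/2\<close> of all pairs of a \<open>C\<close> and a
    frame.\<close>
  have sumG: "(\<delta>/2) * (real (card ?\<C>) * real F) \<le> (\<Sum>C\<in>?\<C>. real (card (G C)))"
  proof -
    have good_half: "real N1 \<le> 2 * real (card {C \<in> subspaces_in c A. good A C})" if A: "A \<in> \<B>" for A
    proof -
      have A': "A \<in> linsubs (Suc (Suc c))" using A k by (simp add: \<B>_def)
      have "real (4 * ?n) * (4 * (1 + \<tau>) / (\<tau>^2 * Ek c S)) \<le> 1/2"
      proof -
        have "real (4 * ?n) * h \<le> real (4 * ?n) * (\<delta>^2 / (8 * real ?n))"
          using h by (intro mult_left_mono) auto
        also have "\<dots> = \<delta>^2 / 2" using assms(1) by simp
        also have "\<dots> \<le> 1/2" using \<delta>2 assms(5) by simp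
        finally show ?thesis by (simp add: h_def e_def)
      qed
      from good_subspaces_majority[OF A' c(1) assms(3) e[unfolded e_def] a[OF A, unfolded k] this]
      have "real (card (subspaces_in c A)) \<le> 2 * real (card {C \<in> subspaces_in c A.
          real (4 * ?n) * real (card (coset A (a A) - X C)) \<le> real ?q ^ Suc (Suc c)})"
        by (simp add: X_def)
      moreover have "real (4 * ?n) * real (card (coset A (a A) - X C)) \<le> real ?q ^ Suc (Suc c)
          \<longleftrightarrow> good A C" for C
        unfolding good_def k of_nat_mult[symmetric] of_nat_power[symmetric] of_nat_le_iff using A by simp
      ultimately show ?thesis using N1[of A] A' k by simp
    qed
    have "(\<delta>/2) * (real (card ?\<C>) * real F) = (\<delta>/2) * real (w * (card ?\<A> * N1))"
      by (simp only: total[symmetric] of_nat_mult)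
    also have "\<dots> = real w * ((\<delta> * real (card ?\<A>)) * (real N1 / 2))" by simp
    also have "\<dots> \<le> real w * (real (card \<B>) * (real N1 / 2))"
      using \<B> by (intro mult_left_mono mult_right_mono) auto
    also have "\<dots> = real w * (\<Sum>A\<in>\<B>. real N1 / 2)" by simp
    also have "\<dots> \<le> real w * (\<Sum>A\<in>\<B>. real (card {C \<in> subspaces_in c A. good A C}))"
      using good_half by (intro mult_left_mono sum_mono) fastforce+
    also have "(\<Sum>A\<in>\<B>. real (card {C \<in> subspaces_in c A. good A C}))
        = (\<Sum>A\<in>?\<A>. real (card {C \<in> subspaces_in c A. good A C}))"
    proof (rule sum.mono_neutral_left)
      show "\<forall>A\<in>?\<A> - \<B>. real (card {C \<in> subspaces_in c A. good A C}) = 0"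
        by (simp add: good_def)
    qed (auto simp: \<B>_def)
    also have "real w * \<dots> = real (w * (\<Sum>A\<in>?\<A>. card {C \<in> subspaces_in c A. good A C}))" by simp
    also have "w * (\<Sum>A\<in>?\<A>. card {C \<in> subspaces_in c A. good A C}) = (\<Sum>C\<in>?\<C>. card (G C))"
      using sum_frames_over_flags[of good c] by (simp only: w_def k G_def)
    finally show ?thesis by simp
  qed
  \<comment> \<open>This \<open>C\<close> will violate \<open>rich_frames_bound\<close>. If there
    were none, summation over all \<open>C\<close> would give
    \<open>\<delta>/2 \<le> 10 * h\<close>, while \<open>n \<ge> 5\<close> and
    \<open>\<delta>^2 \<le> \<delta>\<close> give \<open>10 * h \<le> \<delta>/4\<close>.\<close>
  have "\<exists>C\<in>?\<C>. 10 * real F * real (card (X C)) < real ?q ^ ?n * real (card (G C))"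
  proof (rule ccontr)
    assume "\<not> ?thesis"
    then have "(\<Sum>C\<in>?\<C>. real ?q ^ ?n * real (card (G C))) \<le> (\<Sum>C\<in>?\<C>. 10 * real F * real (card (X C)))"
      by (intro sum_mono) (auto simp: not_less)
    then have "real ?q ^ ?n * (\<Sum>C\<in>?\<C>. real (card (G C))) \<le> 10 * real F * (\<Sum>C\<in>?\<C>. real (card (X C)))"
      by (simp only: sum_distrib_left)
    also have "\<dots> \<le> 10 * real F * (real (card ?\<C>) * real ?q ^ ?n * h)"
      using X by (intro mult_left_mono) auto
    finally have "real ?q ^ ?n * ((\<delta>/2) * (real (card ?\<C>) * real F))
        \<le> 10 * real F * (real (card ?\<C>) * real ?q ^ ?n * h)"
      using mult_left_mono[OF sumG, of "real ?q ^ ?n"] by simp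
    then have "(real ?q ^ ?n * (real (card ?\<C>) * real F)) * (\<delta>/2)
        \<le> (real ?q ^ ?n * (real (card ?\<C>) * real F)) * (10 * h)"
      by (simp add: mult_ac)
    moreover have "real ?q ^ ?n * (real (card ?\<C>) * real F) > 0"
    proof -
      have "4 \<le> ?q" using q assms(1) by linarith
      from frames_majority[OF this c(2)] have "F > 0"
        unfolding F_def by (metis gr0I le_zero_eq mult_0_right power_not_zero zero_less_card_finite not_less0)
      then show ?thesis using card_linsubs_pos[OF c(3), where ?'a = 'a] by simp
    qed
    ultimately have "\<delta>/2 \<le> 10 * h" by (simp only: mult_le_cancel_left_pos)
    also have "\<dots> \<le> 10 * (\<delta>^2 / (8 * real ?n))" using h by simp
    also have "\<dots> \<le> 10 * (\<delta>^2 / (8 * 5))"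
      using assms(1) by (intro mult_left_mono divide_left_mono) auto
    also have "\<dots> \<le> \<delta> / 4" using \<delta>2 by simp
    finally show False using assms(4) by simp
  qed
  then obtain C where C: "C \<in> ?\<C>" "10 * real F * real (card (X C)) < real ?q ^ ?n * real (card (G C))"
    by blast
  from C(2) have "real (10 * F * card (X C)) < real (?q ^ ?n * card (G C))" by simp
  then have less: "10 * card (frames C) * card (X C) < ?q ^ ?n * card (G C)"
    unfolding card_frames[OF C(1)] F_def[symmetric] of_nat_less_iff .
  have GC: "G C \<subseteq> frames C" by (auto simp: G_def)
  have GC': "G C \<noteq> {}" using less by (intro notI) simp
  \<comment> \<open>\<open>N\<close> must be the same for all frames; the least number satisfying
    the inequality lies below every count that satisfies it.\<close>
  define N where "N = (LEAST N. (4 * ?n - 1) * ?q^2 \<le> 4 * ?n * N)"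
  have N: "(4 * ?n - 1) * ?q^2 \<le> 4 * ?n * N"
    unfolding N_def by (rule LeastI[of _ "?q^2"]) simp
  have rich: "rich N (X C) b" if b: "b \<in> G C" for b
  proof -
    obtain b1 b2 where b12: "b = (b1, b2)" by (cases b)
    have "(b1, b2) \<in> frames C" and "good (?sp C b1 b2) C" using b by (auto simp: G_def b12)
    then have "(4 * ?n - 1) * ?q^2
        \<le> 4 * ?n * card {(s,t). a (?sp C b1 b2) + s *s b1 + t *s b2 \<in> X C}"
      using unbalanced_points_invariant[OF C(1)]
      by (intro full_plane_in_full_flat[OF C(1)]) (auto simp: good_def k X_def)
    then have "N \<le> card {(s,t). a (?sp C b1 b2) + s *s b1 + t *s b2 \<in> X C}"
      unfolding N_def by (rule Least_le)
    then show ?thesis by (auto simp: rich_def b12)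
  qed
  have "2 \<le> ?n" using assms(1) by simp
  from rich_frames_bound[OF q this C(1) c(2) GC GC' N rich] less
  show False by simp
qed

end
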